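(* Let $n,m\ge 1$ be integers. Let $\phi_1,\dots,\phi_m\in L^{\infty}_{loc}(\mathbb{R}^n)$ be such that each $\phi_i$ does not change sign in $\mathbb{R}^n$ (that is, for each $i$, either $\phi_i>0$ a.e. in $\mathbb{R}^n$ or $\phi_i<0$ a.e. in $\mathbb{R}^n$), and let $\sigma_1,\dots,\sigma_m\in H^1_{loc}(\mathbb{R}^n)$ be such that $$\limsup_{R\to\infty}\frac{1}{R^2F(R)}\sum_{i=1}^{m}\int_{B_{2R}\setminus B_R}\phi_i^2\sigma_i^2\,dx<\infty$$ for some $F\in\mathcal F$. Suppose also that $(\sigma_i)_{i=1}^m$ satisfies $$\sum_{i=1}^m\sigma_i\,\mathrm{div}(\phi_i^2\nabla\sigma_i)\ge 0\quad\text{in }\mathbb{R}^n.$$ Then for every $i=1,\dots,m$ the function $\sigma_i$ is constant.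
   Context: $B_R$ denotes the ball of radius $R$ centered at the origin of $\mathbb{R}^n$. With $\mathbb{R}^+=(0,\infty)$, the class $\mathcal F$ is $$\mathcal F=\left\{F:\mathbb{R}^+\to\mathbb{R}^+ \ :\ F\text{ is nondecreasing and }\int_2^\infty\frac{dr}{rF(r)}=\infty\right\}.$$ The differential inequality is understood in the weak sense: for every nonnegative $\eta\in C_c^\infty(\mathbb{R}^n)$, $$-\sum_{i=1}^m\int_{\mathbb{R}^n}\phi_i^2\left(|\nabla\sigma_i|^2\eta+\sigma_i\nabla\sigma_i\cdot\nabla\eta\right)dx\ge 0.$$ *)

theory Defs
  imports "HOL-Analysis.Analysis"
begin

definition partial_deriv :: "'n::finite \<Rightarrow> (real^'n \<Rightarrow> real) \<Rightarrow> real^'n \<Rightarrow> real" where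
  "partial_deriv i f x = frechet_derivative f (at x) (axis i 1)"

definition gradient :: "(real^'n::finite \<Rightarrow> real) \<Rightarrow> real^'n \<Rightarrow> real^'n" where
  "gradient f x = (\<chi> i. partial_deriv i f x)"

fun times_cont_diff :: "nat \<Rightarrow> (real^'n::finite \<Rightarrow> real) \<Rightarrow> bool" where
  "times_cont_diff 0 f \<longleftrightarrow> continuous_on UNIV f"
| "times_cont_diff (Suc k) f \<longleftrightarrow>
     (\<forall>x. f differentiable (at x)) \<and> (\<forall>i. times_cont_diff k (partial_deriv i f))"

definition test_functions :: "(real^'n::finite \<Rightarrow> real) set" where
  "test_functions = {\<eta>. (\<forall>k. times_cont_diff k \<eta>) \<and> compact (closure {x. \<eta> x \<noteq> 0})}"

text \<open>Elements of the function spaces below are representatives, Lebesgue measurable on all of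
  the space; nothing is identified up to null sets.\<close>

definition L1_loc :: "('a::euclidean_space \<Rightarrow> 'b::euclidean_space) set" where
  "L1_loc = {u. u \<in> borel_measurable lebesgue \<and>
     (\<forall>K. compact K \<longrightarrow> set_integrable lebesgue K u)}"

definition L2_loc :: "('a::euclidean_space \<Rightarrow> 'b::euclidean_space) set" where
  "L2_loc = {u. u \<in> borel_measurable lebesgue \<and>
     (\<forall>K. compact K \<longrightarrow> set_integrable lebesgue K (\<lambda>x. (norm (u x))\<^sup>2))}"

definition Linf_loc :: "('a::euclidean_space \<Rightarrow> 'b::euclidean_space) set" where
  "Linf_loc = {u. u \<in> borel_measurable lebesgue \<and>
     (\<forall>K. compact K \<longrightarrow> (\<exists>C. AE x in lebesgue. x \<in> K \<longrightarrow> norm (u x) \<le> C))}"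

definition has_weak_gradient :: "(real^'n::finite \<Rightarrow> real) \<Rightarrow> (real^'n \<Rightarrow> real^'n) \<Rightarrow> bool" where
  "has_weak_gradient u G \<longleftrightarrow> u \<in> L1_loc \<and> G \<in> L1_loc \<and>
     (\<forall>\<eta>\<in>test_functions. \<forall>i.
        (LINT x|lebesgue. u x * partial_deriv i \<eta> x) = - (LINT x|lebesgue. G x $ i * \<eta> x))"

text \<open>The weak gradient is unique up to null sets, so the choice of a representative does not
  affect any of the integrals in which it occurs. It is meaningful only for weakly
  differentiable functions.\<close>

definition weak_gradient :: "(real^'n::finite \<Rightarrow> real) \<Rightarrow> real^'n \<Rightarrow> real^'n" where
  "weak_gradient u = (SOME G. has_weak_gradient u G)"

definition H1_loc :: "(real^'n::finite \<Rightarrow> real) set" where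
  "H1_loc = {u. u \<in> L2_loc \<and> (\<exists>G. has_weak_gradient u G) \<and> weak_gradient u \<in> L2_loc}"

text \<open>A function on the positive half-line is represented by a function on all reals
  whose values at nonpositive arguments are irrelevant.\<close>

definition class_F :: "(real \<Rightarrow> real) set" where
  "class_F = {F. (\<forall>r>0. F r > 0) \<and> mono_on {0<..} F \<and>
     (\<integral>\<^sup>+ r\<in>{2..}. ennreal (1 / (r * F r)) \<partial>lborel) = \<infinity>}"

text \<open>The inequality \<open>\<Sum>\<^sub>i \<sigma>\<^sub>i div (\<phi>\<^sub>i\<^sup>2 \<nabla>\<sigma>\<^sub>i) \<ge> 0\<close> in the weak sense.\<close>

definition weak_div_ineq ::
  "nat \<Rightarrow> (nat \<Rightarrow> real^'n::finite \<Rightarrow> real) \<Rightarrow> (nat \<Rightarrow> real^'n \<Rightarrow> real) \<Rightarrow> bool" where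
  "weak_div_ineq m \<phi> \<sigma> \<longleftrightarrow>
     (\<forall>\<eta>\<in>test_functions. (\<forall>x. \<eta> x \<ge> 0) \<longrightarrow>
        - (\<Sum>i=1..m. LINT x|lebesgue. (\<phi> i x)\<^sup>2 *
             ((norm (weak_gradient (\<sigma> i) x))\<^sup>2 * \<eta> x
              + \<sigma> i x * (weak_gradient (\<sigma> i) x \<bullet> gradient \<eta> x))) \<ge> 0)"

end

theory Submission
  imports Defs "HOL-Computational_Algebra.Polynomial"
begin

text \<open>Test the inequality with \<open>\<eta> = \<psi>\<^sup>2\<close>, where \<open>\<psi>\<close> is a cutoff equal to 1 on \<open>B\<^sub>R\<close> and 0 off \<open>B\<^sub>2\<^sub>R\<close>,
  with \<open>R = 2\<^sup>k\<close>. Young's inequality with a free parameter bounds the energy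
  \<open>D\<^sub>k = \<Sum>\<^sub>i \<integral> \<phi>\<^sub>i\<^sup>2 |\<nabla>\<sigma>\<^sub>i|\<^sup>2\<close> over \<open>B\<^sub>R\<close> by \<open>D\<^sub>k \<le> C F(2\<^sup>k)\<close> and
  \<open>D\<^sub>k\<^sup>2 \<le> C F(2\<^sup>k) (D\<^sub>k\<^sub>+\<^sub>1 - D\<^sub>k)\<close>. If some \<open>D\<^sub>k\<close> were positive, then
  \<open>1/D\<^sub>k - 1/D\<^sub>k\<^sub>+\<^sub>1 \<ge> 1/(2 C F(2\<^sup>k))\<close> from there on, and telescoping would make \<open>\<Sum> 1/F(2\<^sup>k)\<close>
  converge, contrary to \<open>F \<in> \<F>\<close>. So the weak gradients vanish. A function with zero weak gradient
  agrees almost everywhere with each of its translates, hence, by Fubini, with a constant.\<close>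

subsection \<open>Smooth functions\<close>

definition smooth :: "(real^'n::finite \<Rightarrow> real) \<Rightarrow> bool" where
  "smooth f \<longleftrightarrow> (\<forall>k. times_cont_diff k f)"

lemma partial_deriv_eqI:
  assumes "(f has_derivative f') (at x)"
  shows "partial_deriv i f x = f' (axis i 1)"
  unfolding partial_deriv_def using frechet_derivative_at[OF assms] by simp

lemma inner_gradient:
  fixes f :: "real^'n::finite \<Rightarrow> real"
  assumes "f differentiable at x"
  shows "gradient f x \<bullet> v = frechet_derivative f (at x) v"
proof -
  have lin: "linear (frechet_derivative f (at x))"
    using assms by (rule linear_frechet_derivative)
  have "frechet_derivative f (at x) v = frechet_derivative f (at x) (\<Sum>i\<in>UNIV. (v $ i) *\<^sub>R axis i 1)"
    by (simp add: basis_expansion scalar_mult_eq_scaleR[symmetric])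
  also have "\<dots> = (\<Sum>i\<in>UNIV. v $ i * frechet_derivative f (at x) (axis i 1))"
    using lin by (simp add: linear_sum linear_cmul)
  finally show ?thesis
    by (simp add: gradient_def partial_deriv_def inner_vec_def mult.commute)
qed

lemma has_derivative_gradient:
  fixes f :: "real^'n::finite \<Rightarrow> real"
  assumes "f differentiable at x"
  shows "(f has_derivative (\<lambda>v. gradient f x \<bullet> v)) (at x)"
  using assms by (simp add: inner_gradient frechet_derivative_works[symmetric])

lemma smooth_continuous: "smooth f \<Longrightarrow> continuous_on S f"
  unfolding smooth_def
  by (metis times_cont_diff.simps(1) continuous_on_subset subset_UNIV)

lemma smooth_differentiable: "smooth f \<Longrightarrow> f differentiable at x"
  unfolding smooth_def by (metis times_cont_diff.simps(2))

lemma smooth_partial_deriv: "smooth f \<Longrightarrow> smooth (partial_deriv i f)"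
  unfolding smooth_def by (metis times_cont_diff.simps(2))

text \<open>The successor clause of \<open>times_cont_diff\<close> does not list continuity of
  \<open>f\<close> itself, so the base case draws it from differentiability. The product rule relies
  on this descent, because it leaves one factor undifferentiated.\<close>

lemma times_cont_diff_SucD: "times_cont_diff (Suc k) f \<Longrightarrow> times_cont_diff k f"
proof (induction k arbitrary: f)
  case 0
  then show ?case
    by (auto intro!: differentiable_imp_continuous_on simp: differentiable_on_def
          intro: differentiable_at_withinI)
qed auto

lemma partial_deriv_add:
  assumes "f differentiable at x" "g differentiable at x"
  shows "partial_deriv i (\<lambda>x. f x + g x) x = partial_deriv i f x + partial_deriv i g x"
  using assms[THEN has_derivative_gradient, THEN partial_deriv_eqI, of i]
    partial_deriv_eqI[OF has_derivative_add[OF assms[THEN has_derivative_gradient]], of i]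
  by simp

lemma partial_deriv_mult:
  assumes "f differentiable at x" "g differentiable at x"
  shows "partial_deriv i (\<lambda>x. f x * g x) x = f x * partial_deriv i g x + partial_deriv i f x * g x"
  using assms[THEN has_derivative_gradient, THEN partial_deriv_eqI, of i]
    partial_deriv_eqI[OF has_derivative_mult[OF assms[THEN has_derivative_gradient]], of i]
  by simp

lemma partial_deriv_compose:
  assumes "f differentiable at x" "(h has_real_derivative h') (at (f x))"
  shows "partial_deriv i (\<lambda>x. h (f x)) x = h' * partial_deriv i f x"
proof -
  have "((\<lambda>x. h (f x)) has_derivative (\<lambda>v. h' * (gradient f x \<bullet> v))) (at x)"
    using has_derivative_compose[OF has_derivative_gradient[OF assms(1)]
        assms(2)[unfolded has_field_derivative_def]] .
  from partial_deriv_eqI[OF this] show ?thesis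
    using partial_deriv_eqI[OF has_derivative_gradient[OF assms(1)]] by simp
qed

lemma partial_deriv_affine:
  assumes "f differentiable at (c *\<^sub>R x + v)"
  shows "partial_deriv i (\<lambda>x. f (c *\<^sub>R x + v)) x = c * partial_deriv i f (c *\<^sub>R x + v)"
proof -
  have "((\<lambda>x. c *\<^sub>R x + v) has_derivative (\<lambda>u. c *\<^sub>R u)) (at x)"
    by (auto intro!: derivative_eq_intros)
  from has_derivative_compose[OF this has_derivative_gradient[OF assms]]
  have "((\<lambda>x. f (c *\<^sub>R x + v)) has_derivative
      (\<lambda>u. gradient f (c *\<^sub>R x + v) \<bullet> c *\<^sub>R u)) (at x)" .
  from partial_deriv_eqI[OF this] show ?thesis
    using partial_deriv_eqI[OF has_derivative_gradient[OF assms]] by simp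
qed

lemma partial_deriv_const: "partial_deriv i (\<lambda>_. c) = (\<lambda>_. 0)"
  by (simp add: partial_deriv_def fun_eq_iff)

lemma smooth_const: "smooth (\<lambda>_ :: real^'n::finite. c)"
proof -
  have "times_cont_diff k (\<lambda>_ :: real^'n. c)" for k and c :: real
    by (induction k arbitrary: c) (auto simp: partial_deriv_const)
  then show ?thesis by (simp add: smooth_def)
qed

lemma times_cont_diff_add:
  "times_cont_diff k f \<Longrightarrow> times_cont_diff k g \<Longrightarrow> times_cont_diff k (\<lambda>x. f x + g x)"
proof (induction k arbitrary: f g)
  case (Suc k)
  then have "partial_deriv i (\<lambda>x. f x + g x) = (\<lambda>x. partial_deriv i f x + partial_deriv i g x)" for i
    by (auto simp: fun_eq_iff partial_deriv_add)
  with Suc show ?case by auto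
qed (auto intro: continuous_intros)

lemma times_cont_diff_mult:
  "times_cont_diff k f \<Longrightarrow> times_cont_diff k g \<Longrightarrow> times_cont_diff k (\<lambda>x. f x * g x)"
proof (induction k arbitrary: f g)
  case (Suc k)
  then have "partial_deriv i (\<lambda>x. f x * g x)
      = (\<lambda>x. f x * partial_deriv i g x + partial_deriv i f x * g x)" for i
    by (auto simp: fun_eq_iff partial_deriv_mult)
  moreover have "times_cont_diff k f" "times_cont_diff k g"
    using Suc.prems by (auto intro: times_cont_diff_SucD)
  ultimately show ?case
    using Suc by (auto intro!: times_cont_diff_add)
qed (auto intro: continuous_intros)

lemma smooth_add: "smooth f \<Longrightarrow> smooth g \<Longrightarrow> smooth (\<lambda>x. f x + g x)"
  and smooth_mult: "smooth f \<Longrightarrow> smooth g \<Longrightarrow> smooth (\<lambda>x. f x * g x)"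
  by (auto simp: smooth_def times_cont_diff_add times_cont_diff_mult)

lemma smooth_diff: "smooth f \<Longrightarrow> smooth g \<Longrightarrow> smooth (\<lambda>x. f x - g x)"
  using smooth_add[OF _ smooth_mult[OF smooth_const[of "-1"]]] by fastforce

lemma smooth_sum: "(\<And>i. i \<in> A \<Longrightarrow> smooth (f i)) \<Longrightarrow> smooth (\<lambda>x. \<Sum>i\<in>A. f i x)"
  by (induction A rule: infinite_finite_induct) (auto intro: smooth_const smooth_add)

lemma smooth_prod: "(\<And>i. i \<in> A \<Longrightarrow> smooth (f i)) \<Longrightarrow> smooth (\<lambda>x. \<Prod>i\<in>A. f i x)"
  by (induction A rule: infinite_finite_induct) (auto intro: smooth_const smooth_mult)

lemma smooth_nth: "smooth (\<lambda>x :: real^'n::finite. x $ j)"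
proof -
  have D: "((\<lambda>x. x $ j) has_derivative (\<lambda>x. x $ j)) (at x)" for x :: "real^'n"
    by (intro bounded_linear.has_derivative[OF bounded_linear_vec_nth] has_derivative_ident)
  have P: "partial_deriv i (\<lambda>x. x $ j) = (\<lambda>_ :: real^'n. axis i 1 $ j)" for i
    using partial_deriv_eqI[OF D] by (auto simp: fun_eq_iff)
  have "times_cont_diff k (\<lambda>x :: real^'n. x $ j)" for k
    using smooth_const D unfolding smooth_def
    by (cases k) (auto simp: P intro: continuous_intros differentiableI[OF D])
  then show ?thesis by (simp add: smooth_def)
qed

lemma smooth_inner_self: "smooth (\<lambda>x. x \<bullet> x)"
  unfolding inner_vec_def inner_real_def by (intro smooth_sum smooth_mult smooth_nth)

lemma times_cont_diff_affine:
  "times_cont_diff k f \<Longrightarrow> times_cont_diff k (\<lambda>x. f (c *\<^sub>R x + v))"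
proof (induction k arbitrary: f)
  case 0
  have "continuous_on UNIV (\<lambda>x. c *\<^sub>R x + v)" by (intro continuous_intros)
  with 0 show ?case using continuous_on_compose2[of UNIV f UNIV "\<lambda>x. c *\<^sub>R x + v"] by auto
next
  case (Suc k)
  then have "partial_deriv i (\<lambda>x. f (c *\<^sub>R x + v)) = (\<lambda>x. c * partial_deriv i f (c *\<^sub>R x + v))" for i
    by (auto simp: fun_eq_iff partial_deriv_affine)
  moreover have "times_cont_diff k (\<lambda>_. c)"
    using smooth_const by (auto simp: smooth_def)
  moreover have "(\<lambda>x. f (c *\<^sub>R x + v)) differentiable at x" for x
    by (rule differentiable_compose[of f "\<lambda>x. c *\<^sub>R x + v"]) (use Suc.prems in auto)
  ultimately show ?case
    using Suc by (auto intro!: times_cont_diff_mult)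
qed

lemma smooth_affine: "smooth f \<Longrightarrow> smooth (\<lambda>x. f (c *\<^sub>R x + v))"
  by (auto simp: smooth_def times_cont_diff_affine)

text \<open>The outer function enters as the whole sequence \<open>H\<close> of its derivatives. By
  the chain rule, differentiating \<open>H j (f x)\<close> produces \<open>H (Suc j) (f x)\<close>,
  so the induction on the order must hold for all \<open>j\<close> at once.\<close>

lemma smooth_compose:
  fixes f :: "real^'n::finite \<Rightarrow> real" and H :: "nat \<Rightarrow> real \<Rightarrow> real"
  assumes H: "\<And>j t. (H j has_real_derivative H (Suc j) t) (at t)" and f: "smooth f"
  shows "smooth (\<lambda>x. H 0 (f x))"
proof -
  have "times_cont_diff k (\<lambda>x. H j (f x))" for k j
  proof (induction k arbitrary: j)
    case 0
    have "continuous_on UNIV (H j)"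
      using H by (meson DERIV_isCont continuous_at_imp_continuous_on)
    then show ?case
      using continuous_on_compose2[OF _ smooth_continuous[OF f], of UNIV "H j"] by simp
  next
    case (Suc k)
    have "partial_deriv i (\<lambda>x. H j (f x)) = (\<lambda>x. H (Suc j) (f x) * partial_deriv i f x)" for i
      by (auto simp: fun_eq_iff intro!: partial_deriv_compose H smooth_differentiable f)
    moreover have "(\<lambda>x. H j (f x)) differentiable at x" for x
      by (rule differentiable_compose[of "H j" f])
        (use H f in \<open>auto simp: real_differentiable_def intro: smooth_differentiable\<close>)
    ultimately show ?case
      using Suc smooth_partial_deriv[OF f] by (auto simp: smooth_def intro!: times_cont_diff_mult)
  qed
  then show ?thesis by (simp add: smooth_def)
qed

section \<open>The flat function exp(-1/t)\<close>

text \<open>The \<open>k\<close>-th derivative of \<open>exp (-1/t)\<close> is \<open>p\<^sub>k (1/t) exp (-1/t)\<close>, where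
  \<open>p\<^sub>k\<^sub>+\<^sub>1 (z) = z\<^sup>2 (p\<^sub>k (z) - p\<^sub>k' (z))\<close>.\<close>

primrec exp_inv_poly :: "nat \<Rightarrow> real poly" where
  "exp_inv_poly 0 = 1"
| "exp_inv_poly (Suc k) = [:0, 0, 1:] * (exp_inv_poly k - pderiv (exp_inv_poly k))"

definition exp_inv_deriv :: "nat \<Rightarrow> real \<Rightarrow> real" where
  "exp_inv_deriv k t = (if t \<le> 0 then 0 else poly (exp_inv_poly k) (1 / t) * exp (- 1 / t))"

definition exp_inv :: "real \<Rightarrow> real" where
  "exp_inv t = (if t \<le> 0 then 0 else exp (- 1 / t))"

lemma poly_times_exp_minus_tendsto_0: "((\<lambda>t. poly p t * exp (- t)) \<longlongrightarrow> (0::real)) at_top"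
proof -
  have "((\<lambda>t. \<Sum>i\<le>degree p. coeff p i * (t ^ i / exp t)) \<longlongrightarrow> (\<Sum>i\<le>degree p. coeff p i * 0)) at_top"
    by (intro tendsto_intros tendsto_power_div_exp_0)
  moreover have "(\<lambda>t. \<Sum>i\<le>degree p. coeff p i * (t ^ i / exp t)) = (\<lambda>t. poly p t * exp (- t))"
    by (simp add: fun_eq_iff poly_altdef sum_distrib_right exp_minus divide_inverse mult.assoc)
  ultimately show ?thesis by simp
qed

lemma exp_inv_deriv_has_derivative:
  "(exp_inv_deriv k has_real_derivative exp_inv_deriv (Suc k) t) (at t)"
proof -
  consider "t < 0" | "t > 0" | "t = 0" by linarith
  then show ?thesis
  proof cases
    case 1
    have "((\<lambda>_. 0) has_real_derivative exp_inv_deriv (Suc k) t) (at t)"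
      using 1 by (auto simp: exp_inv_deriv_def)
    moreover have "eventually (\<lambda>s. s < 0) (nhds t)"
      using 1 eventually_nhds_in_open[of "{..<0}" t] by auto
    then have "eventually (\<lambda>s. 0 = exp_inv_deriv k s) (nhds t)"
      by eventually_elim (auto simp: exp_inv_deriv_def)
    ultimately show ?thesis
      using DERIV_cong_ev[OF refl _ refl] by fastforce
  next
    case 2
    have "((\<lambda>s. poly (exp_inv_poly k) (1 / s) * exp (- 1 / s)) has_real_derivative
        poly (pderiv (exp_inv_poly k)) (1 / t) * (- 1 / t\<^sup>2) * exp (- 1 / t)
        + poly (exp_inv_poly k) (1 / t) * (exp (- 1 / t) * (1 / t\<^sup>2))) (at t)"
      using 2 by (auto intro!: derivative_eq_intros DERIV_chain2[OF poly_DERIV] simp: power2_eq_square)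
    moreover have "poly (pderiv (exp_inv_poly k)) (1 / t) * (- 1 / t\<^sup>2) * exp (- 1 / t)
        + poly (exp_inv_poly k) (1 / t) * (exp (- 1 / t) * (1 / t\<^sup>2)) = exp_inv_deriv (Suc k) t"
      using 2 by (simp add: exp_inv_deriv_def field_simps power2_eq_square)
    moreover have "eventually (\<lambda>s. s > 0) (nhds t)"
      using 2 eventually_nhds_in_open[of "{0<..}" t] by auto
    then have "eventually (\<lambda>s. poly (exp_inv_poly k) (1 / s) * exp (- 1 / s) = exp_inv_deriv k s) (nhds t)"
      by eventually_elim (auto simp: exp_inv_deriv_def)
    ultimately show ?thesis
      using DERIV_cong_ev[OF refl _ refl] by fastforce
  next
    case 3
    \<comment> \<open>At 0 only the right-hand difference quotient is delicate. With z = 1/h it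
      equals z p(z) exp(-z); \<open>pCons 0\<close> supplies the extra factor z, and the exponential
      beats every polynomial.\<close>
    have "((\<lambda>h. poly (pCons 0 (exp_inv_poly k)) (inverse h) * exp (- inverse h)) \<longlongrightarrow> 0) (at_right 0)"
      by (rule filterlim_compose[OF poly_times_exp_minus_tendsto_0 filterlim_inverse_at_top_right])
    then have "((\<lambda>h. exp_inv_deriv k h / h) \<longlongrightarrow> 0) (at_right 0)"
      by (rule Lim_transform_eventually)
        (auto simp: eventually_at_filter exp_inv_deriv_def field_simps)
    moreover have "((\<lambda>h. exp_inv_deriv k h / h) \<longlongrightarrow> 0) (at_left 0)"
      by (rule Lim_transform_eventually[OF tendsto_const])
        (auto simp: eventually_at_filter exp_inv_deriv_def)
    ultimately have "((\<lambda>h. exp_inv_deriv k h / h) \<longlongrightarrow> 0) (at 0)"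
      by (simp add: filterlim_split_at_real)
    then show ?thesis
      using 3 by (simp add: DERIV_def exp_inv_deriv_def)
  qed
qed

lemma exp_inv_eq_deriv_0: "exp_inv = exp_inv_deriv 0"
  by (auto simp: fun_eq_iff exp_inv_def exp_inv_deriv_def)

lemma smooth_exp_inv: "smooth f \<Longrightarrow> smooth (\<lambda>x. exp_inv (f x))"
  unfolding exp_inv_eq_deriv_0
  by (rule smooth_compose) (rule exp_inv_deriv_has_derivative)

lemma exp_inv_nonneg: "0 \<le> exp_inv t"
  and exp_inv_le_1: "exp_inv t \<le> 1"
  by (auto simp: exp_inv_def)

lemma exp_inv_mono: "s \<le> t \<Longrightarrow> exp_inv s \<le> exp_inv t"
  by (auto simp: exp_inv_def field_simps)

subsection \<open>Test functions\<close>

text \<open>By Heine-Borel the closure of the support is compact exactly when the support is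
  bounded. A radius is easier to handle than a compact set under translation, scaling and
  differentiation.\<close>

lemma test_functions_iff_smooth: "\<eta> \<in> test_functions \<longleftrightarrow> smooth \<eta> \<and> (\<exists>r. \<forall>x. r < norm x \<longrightarrow> \<eta> x = 0)"
proof -
  have "compact (closure {x. \<eta> x \<noteq> 0}) \<longleftrightarrow> (\<exists>r. \<forall>x. \<eta> x \<noteq> 0 \<longrightarrow> norm x \<le> r)"
    by (simp add: compact_closure bounded_iff)
  also have "\<dots> \<longleftrightarrow> (\<exists>r. \<forall>x. r < norm x \<longrightarrow> \<eta> x = 0)"
    by (meson linorder_not_less)
  finally show ?thesis
    by (simp add: test_functions_def smooth_def)
qed

lemma test_functionI: "smooth \<eta> \<Longrightarrow> (\<And>x. r < norm x \<Longrightarrow> \<eta> x = 0) \<Longrightarrow> \<eta> \<in> test_functions"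
  unfolding test_functions_iff_smooth by blast

lemma test_functionE:
  assumes "\<eta> \<in> test_functions"
  obtains r where "smooth \<eta>" "\<forall>x. r < norm x \<longrightarrow> \<eta> x = 0"
  using assms unfolding test_functions_iff_smooth by blast

lemma test_function_partial_deriv:
  assumes "\<eta> \<in> test_functions"
  shows "partial_deriv i \<eta> \<in> test_functions"
proof -
  from assms obtain r where s: "smooth \<eta>" and r: "\<forall>x. r < norm x \<longrightarrow> \<eta> x = 0"
    by (rule test_functionE)
  show ?thesis
  proof (rule test_functionI[where r = r])
    fix x :: "real^'a" assume "r < norm x"
    \<comment> \<open>Strictness of the inequality makes the region open, so \<open>\<eta>\<close>
      agrees with 0 in a neighbourhood of \<open>x\<close> and its derivative there is that of
      0.\<close>
    moreover have "open {x :: real^'a. r < norm x}"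
      by (intro open_Collect_less continuous_intros)
    ultimately have "frechet_derivative \<eta> (at x) = frechet_derivative (\<lambda>_. 0) (at x)"
      using s r by (intro frechet_derivative_transform_within_open[where X = "{x. r < norm x}"])
        (auto intro: smooth_differentiable)
    then show "partial_deriv i \<eta> x = 0"
      by (simp add: partial_deriv_def)
  qed (use s in \<open>rule smooth_partial_deriv\<close>)
qed

lemma test_function_affine:
  assumes "\<eta> \<in> test_functions" "c \<noteq> 0"
  shows "(\<lambda>x. \<eta> (c *\<^sub>R x + v)) \<in> test_functions"
proof -
  from assms(1) obtain r where s: "smooth \<eta>" and r: "\<forall>x. r < norm x \<longrightarrow> \<eta> x = 0"
    by (rule test_functionE)
  show ?thesis
  proof (rule test_functionI[where r = "(r + norm v) / \<bar>c\<bar>"])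
    fix x :: "real^'a" assume "(r + norm v) / \<bar>c\<bar> < norm x"
    then have "r + norm v < norm (c *\<^sub>R x)"
      using \<open>c \<noteq> 0\<close> by (simp add: field_simps)
    then have "r < norm (c *\<^sub>R x + v)"
      using norm_triangle_ineq4[of "c *\<^sub>R x + v" v] by simp
    then show "\<eta> (c *\<^sub>R x + v) = 0" using r by blast
  qed (use s in \<open>rule smooth_affine\<close>)
qed

lemma test_function_bounded:
  assumes "\<eta> \<in> test_functions"
  obtains M where "0 \<le> M" "\<forall>x. \<bar>\<eta> x\<bar> \<le> M"
proof -
  from assms obtain r where s: "smooth \<eta>" and r: "\<forall>x. r < norm x \<longrightarrow> \<eta> x = 0"
    by (rule test_functionE)
  have "bounded (\<eta> ` cball 0 r)"
    by (intro compact_imp_bounded compact_continuous_image smooth_continuous s compact_cball)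
  then obtain B where B: "\<forall>x\<in>cball 0 r. \<bar>\<eta> x\<bar> \<le> B"
    unfolding bounded_iff by auto
  show ?thesis
  proof (rule that[of "max 0 B"])
    show "\<forall>x. \<bar>\<eta> x\<bar> \<le> max 0 B"
      using B r by (auto simp: le_max_iff_disj)
  qed simp
qed

section \<open>Integration against test functions and the fundamental lemma of the calculus of
  variations\<close>

lemma smooth_lebesgue_measurable: "smooth f \<Longrightarrow> f \<in> borel_measurable lebesgue"
  by (intro measurable_completion) (simp add: borel_measurable_continuous_onI smooth_continuous)

lemma integrable_mult_bounded_support:
  fixes w h :: "'a::euclidean_space \<Rightarrow> real"
  assumes w: "set_integrable lebesgue K w" and h: "h \<in> borel_measurable lebesgue"
    and M: "\<And>x. \<bar>h x\<bar> \<le> M" and supp: "\<And>x. x \<notin> K \<Longrightarrow> h x = 0"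
  shows "integrable lebesgue (\<lambda>x. w x * h x)"
proof -
  have *: "(\<lambda>x. w x * h x) = (\<lambda>x. (indicator K x *\<^sub>R w x) * h x)"
    using supp by (auto simp: fun_eq_iff indicator_def)
  have int: "integrable lebesgue (\<lambda>x. M * (indicator K x *\<^sub>R w x))"
    using w by (intro integrable_mult_right) (simp add: set_integrable_def)
  show ?thesis
    unfolding *
  proof (rule Bochner_Integration.integrable_bound[OF int])
    show "(\<lambda>x. (indicator K x *\<^sub>R w x) * h x) \<in> borel_measurable lebesgue"
      using w h unfolding set_integrable_def by (intro borel_measurable_times) auto
    have "\<bar>h x\<bar> \<le> \<bar>M\<bar>" for x
      using M[of x] by linarith
    then show "AE x in lebesgue. norm ((indicator K x *\<^sub>R w x) * h x) \<le> norm (M * (indicator K x *\<^sub>R w x))"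
      by (intro AE_I2) (auto simp: abs_mult mult.commute intro!: mult_right_mono)
  qed
qed

lemma integrable_mult_test_function:
  assumes w: "\<And>K. compact K \<Longrightarrow> set_integrable lebesgue K w" and "\<eta> \<in> test_functions"
  shows "integrable lebesgue (\<lambda>x. w x * \<eta> x)"
proof -
  from assms(2) obtain r where s: "smooth \<eta>" and r: "\<forall>x. r < norm x \<longrightarrow> \<eta> x = 0"
    by (rule test_functionE)
  from assms(2) obtain M where "\<forall>x. \<bar>\<eta> x\<bar> \<le> M"
    by (rule test_function_bounded)
  then show ?thesis
    using r by (intro integrable_mult_bounded_support[OF w[of "cball 0 r"]])
      (auto intro: smooth_lebesgue_measurable s)
qed

text \<open>A smooth approximation of the indicator of the open box. Each factor vanishes beyond its
  face and tends to 1 inside as \<open>k\<close> grows; \<open>Suc k\<close> keeps the scale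
  positive for every \<open>k\<close>.\<close>

definition box_bump :: "real^'n::finite \<Rightarrow> real^'n \<Rightarrow> nat \<Rightarrow> real^'n \<Rightarrow> real" where
  "box_bump a b k x =
     (\<Prod>i\<in>UNIV. exp_inv (real (Suc k) * (x $ i - a $ i)) * exp_inv (real (Suc k) * (b $ i - x $ i)))"

lemma box_bump_outside: "x \<notin> box a b \<Longrightarrow> box_bump a b k x = 0"
  unfolding mem_box_cart box_bump_def exp_inv_def
  by (fastforce simp: not_less mult_le_0_iff intro: prod_zero)

lemma box_bump_bounds: "0 \<le> box_bump a b k x" "box_bump a b k x \<le> 1"
  unfolding box_bump_def
  by (auto intro!: prod_nonneg prod_le_1 mult_nonneg_nonneg mult_le_one exp_inv_nonneg exp_inv_le_1)

lemma box_bump_test_function: "box_bump a b k \<in> test_functions"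
proof -
  obtain r where "\<And>x. x \<in> box a b \<Longrightarrow> norm x \<le> r"
    using bounded_box[of a b] unfolding bounded_iff by auto
  then have "box_bump a b k x = 0" if "r < norm x" for x
    using that by (intro box_bump_outside) force
  moreover have "smooth (box_bump a b k)"
    unfolding box_bump_def[abs_def]
    by (intro smooth_prod smooth_mult smooth_exp_inv smooth_diff smooth_const smooth_nth)
  ultimately show ?thesis by (rule test_functionI[rotated])
qed

lemma exp_inv_scaled_tendsto:
  assumes "t > 0"
  shows "(\<lambda>k. exp_inv (real (Suc k) * t)) \<longlonglongrightarrow> 1"
proof -
  have "(\<lambda>k. - (1 / t) * inverse (real (Suc k))) \<longlonglongrightarrow> - (1 / t) * 0"
    by (intro tendsto_intros LIMSEQ_inverse_real_of_nat)
  then have "(\<lambda>k. exp (- (1 / t) * inverse (real (Suc k)))) \<longlonglongrightarrow> exp 0"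
    by (intro tendsto_exp) simp
  moreover have "exp_inv (real (Suc k) * t) = exp (- (1 / t) * inverse (real (Suc k)))" for k
    using assms mult_pos_pos[of "real (Suc k)" t] by (simp add: exp_inv_def inverse_eq_divide mult.commute not_le del: of_nat_Suc)
  ultimately show ?thesis by simp
qed

lemma box_bump_tendsto: "(\<lambda>k. box_bump a b k x) \<longlonglongrightarrow> indicator (box a b) x"
proof (cases "x \<in> box a b")
  case True
  then have "(\<lambda>k. box_bump a b k x) \<longlonglongrightarrow> (\<Prod>i\<in>(UNIV :: 'a set). 1 * 1)"
    unfolding box_bump_def
    by (intro tendsto_prod tendsto_mult exp_inv_scaled_tendsto) (auto simp: mem_box_cart)
  with True show ?thesis by simp
qed (simp add: box_bump_outside)

text \<open>The functions \<open>box_bump a b k\<close> are test functions with values in [0, 1]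
  that converge pointwise to the indicator of the box, so dominated convergence transfers the
  vanishing integrals to the box.\<close>

lemma integral_box_eq_0:
  fixes w :: "real^'n::finite \<Rightarrow> real"
  assumes w: "w \<in> L1_loc"
    and 0: "\<And>\<eta>. \<eta> \<in> test_functions \<Longrightarrow> (LINT x|lebesgue. w x * \<eta> x) = 0"
  shows "(LINT x:box a b|lebesgue. w x) = 0"
proof -
  have wm: "w \<in> borel_measurable lebesgue"
    and wi: "\<And>K. compact K \<Longrightarrow> set_integrable lebesgue K w"
    using w by (auto simp: L1_loc_def)
  have "(\<lambda>k. LINT x|lebesgue. w x * box_bump a b k x) \<longlonglongrightarrow> (LINT x|lebesgue. w x * indicator (box a b) x)"
  \<comment> \<open>The majorant lives on the closed box because local integrability speaks of
    compact sets.\<close>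
  proof (rule integral_dominated_convergence[where w = "\<lambda>x. norm (indicator (cbox a b) x *\<^sub>R w x)"])
    show "integrable lebesgue (\<lambda>x. norm (indicator (cbox a b) x *\<^sub>R w x))"
      using wi[of "cbox a b"] unfolding set_integrable_def by (intro integrable_norm) auto
    show "(\<lambda>x. w x * box_bump a b k x) \<in> borel_measurable lebesgue" for k
      by (rule borel_measurable_times[OF wm], rule test_functionE[OF box_bump_test_function])
        (rule smooth_lebesgue_measurable)
    show "(\<lambda>x. w x * indicator (box a b) x) \<in> borel_measurable lebesgue"
      by (intro borel_measurable_times borel_measurable_indicator wm) auto
    have "norm (w x * box_bump a b k x) \<le> norm (indicator (cbox a b) x *\<^sub>R w x)" for k x
      using box_bump_bounds[of a b k x] box_bump_outside[of x a b k] box_subset_cbox[of a b]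
      by (cases "x \<in> box a b") (auto simp: abs_mult mult_left_le)
    then show "AE x in lebesgue. norm (w x * box_bump a b k x) \<le> norm (indicator (cbox a b) x *\<^sub>R w x)" for k
      by simp
  qed (auto intro!: tendsto_mult box_bump_tendsto)
  moreover have "(LINT x|lebesgue. w x * box_bump a b k x) = 0" for k
    by (intro 0 box_bump_test_function)
  ultimately have "(LINT x|lebesgue. w x * indicator (box a b) x) = 0"
    by (simp add: LIMSEQ_const_iff)
  then show ?thesis
    by (simp add: set_lebesgue_integral_def mult.commute)
qed

text \<open>Open boxes are stable under intersection and generate the Borel sets, so a Dynkin class
  argument extends the vanishing of the integral from boxes to all Borel sets. A function with all
  these integrals zero is zero almost everywhere.\<close>

lemma AE_zero_if_integral_box_zero:
  fixes w :: "'a::euclidean_space \<Rightarrow> real"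
  assumes w: "w \<in> L1_loc" and 0: "\<And>a b. (LINT x:box a b|lebesgue. w x) = 0"
  shows "AE x in lebesgue. w x = 0"
proof -
  have wm: "w \<in> borel_measurable lebesgue"
    and wi: "\<And>K. compact K \<Longrightarrow> set_integrable lebesgue K w"
    using w by (auto simp: L1_loc_def)
  have "AE x in lebesgue. x \<in> box (- (real n *\<^sub>R One)) (real n *\<^sub>R One) \<longrightarrow> w x = 0" for n
  proof -
    \<comment> \<open>Restricting to a bounded box makes \<open>f\<close> integrable on the whole
      space, which the complement step of the induction needs. Since \<open>Q\<close> is itself a
      box, the total integral of \<open>f\<close> is also 0.\<close>
    define Q :: "'a set" where "Q = box (- (real n *\<^sub>R One)) (real n *\<^sub>R One)"
    define f where "f x = indicator Q x *\<^sub>R w x" for x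
    have fi: "integrable lebesgue f"
    proof -
      have "set_integrable lebesgue Q w"
        by (rule set_integrable_subset[OF wi[OF compact_cbox]])
          (auto simp: Q_def intro: box_subset_cbox[THEN subsetD])
      then show ?thesis by (simp add: set_integrable_def f_def[abs_def])
    qed
    have fA: "set_integrable lebesgue A f" if "A \<in> sets lborel" for A
      using integrable_mult_indicator[OF _ fi, of A] that by (simp add: set_integrable_def)
    have f0: "(LINT x:A|lebesgue. f x) = 0" if A: "A \<in> sets lborel" for A
    proof -
      let ?G = "range (\<lambda>(a, b). box a b :: 'a set)"
      have B: "sets lborel = sigma_sets UNIV ?G"
        by (simp add: borel_eq_box)
      have "Int_stable ?G"
        by (auto simp: Int_stable_def box_Int_box)
      moreover have "?G \<subseteq> Pow UNIV" by simp
      moreover have "A \<in> sigma_sets UNIV ?G"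
        using A by (simp only: B)
      ultimately show ?thesis
      proof (induction rule: sigma_sets_induct_disjoint)
        case (basic A)
        then obtain a b where "A = box a b" by auto
        then obtain c d where "A \<inter> Q = box c d"
          by (auto simp: Q_def box_Int_box)
        moreover have "(LINT x:A|lebesgue. f x) = (LINT x:A \<inter> Q|lebesgue. w x)"
          by (simp add: set_lebesgue_integral_def f_def indicator_inter_arith mult.assoc)
        ultimately show ?case using 0 by simp
      next
        case (compl A)
        then have A: "A \<in> sets lborel" by (simp only: B)
        have "(LINT x|lebesgue. f x) = (LINT x:A \<union> (UNIV - A)|lebesgue. f x)"
          by (simp add: set_lebesgue_integral_def)
        also have "\<dots> = (LINT x:A|lebesgue. f x) + (LINT x:UNIV - A|lebesgue. f x)"
          using A by (intro set_integral_Un fA) auto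
        finally show ?case
          using compl 0 by (simp add: f_def set_lebesgue_integral_def Q_def)
      next
        case (union A)
        then have "\<And>i. A i \<in> sets lborel" by (subst B) auto
        then have "(LINT x:(\<Union>i. A i)|lebesgue. f x) = (\<Sum>i. LINT x:A i|lebesgue. f x)"
          using union(1) by (intro lebesgue_integral_countable_add fA)
            (auto simp: disjoint_family_on_def)
        then show ?case using union by simp
      qed (auto simp: set_lebesgue_integral_def)
    qed
    \<comment> \<open>\<open>f\<close> is only Lebesgue measurable, whereas the uniqueness of
      densities is applied over \<open>lborel\<close>. A Borel representative \<open>g\<close>
      bridges the two measures.\<close>
    obtain g where g: "g \<in> borel_measurable lborel" "AE x in lborel. f x = g x"
      using completion_ex_borel_measurable_real[of f lborel] fi by auto
    then have ae: "AE x in lebesgue. f x = g x" by (intro AE_completion)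
    have gm: "g \<in> borel_measurable lebesgue" using g(1) by (rule measurable_completion)
    have "AE x in lborel. g x = 0"
    proof (rule sigma_finite_measure.density_zero[OF sigma_finite_lborel])
      have "integrable lebesgue g"
        by (rule integrable_cong_AE_imp[OF fi gm ae])
      then show "integrable lborel g"
        using g by (simp add: integrable_completion)
      fix A assume A: "A \<in> sets (lborel :: 'a measure)"
      have "(LINT x:A|lborel. g x) = (LINT x:A|lebesgue. g x)"
        using A g unfolding set_lebesgue_integral_def by (subst integral_completion) auto
      also have "\<dots> = (LINT x:A|lebesgue. f x)"
        unfolding set_lebesgue_integral_def
      proof (rule integral_cong_AE)
        have "A \<in> sets lebesgue" using A by simp
        then show "(\<lambda>x. indicat_real A x *\<^sub>R g x) \<in> borel_measurable lebesgue"
          by (intro borel_measurable_scaleR borel_measurable_indicator gm)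
        show "(\<lambda>x. indicat_real A x *\<^sub>R f x) \<in> borel_measurable lebesgue"
          using fA[OF A] by (simp add: set_integrable_def)
        show "AE x in lebesgue. indicat_real A x *\<^sub>R g x = indicat_real A x *\<^sub>R f x"
          using ae by eventually_elim simp
      qed
      finally show "(LINT x:A|lborel. g x) = 0"
        using f0[OF A] by simp
    qed
    with g(2) have "AE x in lborel. f x = 0" by eventually_elim simp
    then have "AE x in lebesgue. f x = 0" by (rule AE_completion)
    then show ?thesis
      by eventually_elim (auto simp: f_def Q_def)
  qed
  then have "AE x in lebesgue. \<forall>n. x \<in> box (- (real n *\<^sub>R One)) (real n *\<^sub>R One) \<longrightarrow> w x = 0"
    unfolding AE_all_countable ..
  then show ?thesis
  proof eventually_elim
    case (elim x)
    then show ?case using UN_box_eq_UNIV by blast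
  qed
qed

lemma fundamental_lemma_calculus_of_variations:
  fixes w :: "real^'n::finite \<Rightarrow> real"
  assumes "w \<in> L1_loc"
    and "\<And>\<eta>. \<eta> \<in> test_functions \<Longrightarrow> (LINT x|lebesgue. w x * \<eta> x) = 0"
  shows "AE x in lebesgue. w x = 0"
  using assms by (intro AE_zero_if_integral_box_zero integral_box_eq_0)

subsection \<open>Functions with vanishing weak gradient\<close>

lemma line_has_real_derivative:
  fixes \<eta> :: "real^'n::finite \<Rightarrow> real"
  assumes "smooth \<eta>"
  shows "((\<lambda>s. \<eta> (x + s *\<^sub>R axis i 1)) has_real_derivative partial_deriv i \<eta> (x + t *\<^sub>R axis i 1)) (at t within S)"
proof -
  have "((\<lambda>s. x + s *\<^sub>R axis i 1) has_derivative (\<lambda>s. s *\<^sub>R axis i 1)) (at t within S)"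
    by (auto intro!: derivative_eq_intros)
  from has_derivative_compose[OF this has_derivative_gradient[OF smooth_differentiable[OF assms]]]
  show ?thesis
    by (simp add: has_field_derivative_def gradient_def inner_axis mult.commute[of _ "partial_deriv _ _ _"])
qed

text \<open>The mean value inequality is used twice, first for the derivative along the line and
  then for the function minus its tangent. This yields the constant \<open>M\<close> instead of the
  sharp \<open>M / 2\<close>; only the quadratic order in \<open>h\<close> matters later.\<close>

lemma line_taylor_bound:
  fixes \<eta> :: "real^'n::finite \<Rightarrow> real"
  assumes s: "smooth \<eta>" and M: "\<forall>x. \<bar>partial_deriv i (partial_deriv i \<eta>) x\<bar> \<le> M"
  shows "\<bar>\<eta> (x + h *\<^sub>R axis i 1) - \<eta> x - h * partial_deriv i \<eta> x\<bar> \<le> M * h\<^sup>2"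
proof -
  let ?D = "\<lambda>t. partial_deriv i \<eta> (x + t *\<^sub>R axis i 1)"
  have M0: "0 \<le> M" using M[rule_format, of 0] by linarith
  have D: "\<bar>?D t - ?D 0\<bar> \<le> M * \<bar>t\<bar>" for t
    using field_differentiable_bound[of UNIV ?D "\<lambda>t. partial_deriv i (partial_deriv i \<eta>) (x + t *\<^sub>R axis i 1)" M t 0]
      line_has_real_derivative[OF smooth_partial_deriv[OF s]] M by auto
  \<comment> \<open>The symmetric interval contains both 0 and \<open>h\<close>, whatever the sign
    of \<open>h\<close>.\<close>
  have "norm ((\<eta> (x + h *\<^sub>R axis i 1) - h * ?D 0) - (\<eta> (x + 0 *\<^sub>R axis i 1) - 0 * ?D 0)) \<le> (M * \<bar>h\<bar>) * norm (h - 0)"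
  proof (rule field_differentiable_bound[of "{-\<bar>h\<bar>..\<bar>h\<bar>}" _ "\<lambda>t. ?D t - ?D 0"])
    fix t assume t: "t \<in> {-\<bar>h\<bar>..\<bar>h\<bar>}"
    show "((\<lambda>t. \<eta> (x + t *\<^sub>R axis i 1) - t * ?D 0) has_real_derivative ?D t - ?D 0) (at t within {-\<bar>h\<bar>..\<bar>h\<bar>})"
      by (auto intro!: derivative_eq_intros line_has_real_derivative s)
    have "M * \<bar>t\<bar> \<le> M * \<bar>h\<bar>" using t M0 by (intro mult_left_mono) auto
    with D[of t] show "norm (?D t - ?D 0) \<le> M * \<bar>h\<bar>" by simp
  qed auto
  then show ?thesis
    by (simp add: power2_eq_square algebra_simps flip: abs_mult)
qed

lemma L1_locD: "u \<in> L1_loc \<Longrightarrow> compact K \<Longrightarrow> set_integrable lebesgue K u"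
  by (simp add: L1_loc_def)

text \<open>Formally the derivative is the integral of \<open>u\<close> times
  \<open>partial_deriv i \<eta>\<close>, which vanishes by hypothesis. The Taylor remainder
  justifies this: it is quadratic in \<open>h\<close>, uniformly in \<open>x\<close>, and supported
  in a fixed compact set where \<open>u\<close> is integrable.\<close>

lemma shifted_integral_has_derivative_0:
  fixes u :: "real^'n::finite \<Rightarrow> real"
  assumes u: "u \<in> L1_loc"
    and 0: "\<And>\<eta> i. \<eta> \<in> test_functions \<Longrightarrow> (LINT x|lebesgue. u x * partial_deriv i \<eta> x) = 0"
    and \<eta>: "\<eta> \<in> test_functions"
  shows "((\<lambda>s. LINT x|lebesgue. u x * \<eta> (x + s *\<^sub>R axis i 1)) has_real_derivative 0) (at 0)"
proof -
  let ?T = "\<lambda>s. LINT x|lebesgue. u x * \<eta> (x + s *\<^sub>R axis i 1)"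
  from \<eta> obtain r where s: "smooth \<eta>" and r: "\<forall>x. r < norm x \<longrightarrow> \<eta> x = 0"
    by (rule test_functionE)
  from test_function_partial_deriv[OF \<eta>, of i] obtain r' where r': "\<forall>x. r' < norm x \<longrightarrow> partial_deriv i \<eta> x = 0"
    by (rule test_functionE)
  obtain M where M0: "0 \<le> M" and M: "\<forall>x. \<bar>partial_deriv i (partial_deriv i \<eta>) x\<bar> \<le> M"
    by (rule test_function_bounded[OF test_function_partial_deriv[OF test_function_partial_deriv[OF \<eta>, of i], of i]])
  \<comment> \<open>The margin 1 absorbs shifts with \<open>\<bar>h\<bar> \<le> 1\<close>: outside
    \<open>K\<close> the function, its shift and its partial derivative all vanish.\<close>
  define K where "K = cball (0 :: real^'n) (max r' (r + 1))"
  define C where "C = (LINT x:K|lebesgue. M * \<bar>u x\<bar>)"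
  have Kint: "set_integrable lebesgue K (\<lambda>x. M * \<bar>u x\<bar>)"
    using set_integrable_abs[OF L1_locD[OF u, of K]] unfolding K_def by (intro set_integrable_mult_right) auto
  have int: "integrable lebesgue (\<lambda>x. u x * \<eta> (x + h *\<^sub>R axis i 1))" for h
    using integrable_mult_test_function[OF L1_locD[OF u] test_function_affine[OF \<eta>, of 1 "h *\<^sub>R axis i 1"]]
    by simp
  have int': "integrable lebesgue (\<lambda>x. u x * partial_deriv i \<eta> x)"
    by (intro integrable_mult_test_function L1_locD u test_function_partial_deriv \<eta>)
  have bound: "\<bar>?T h - ?T 0\<bar> \<le> C * h\<^sup>2" if h: "\<bar>h\<bar> \<le> 1" for h
  proof -
    let ?R = "\<lambda>x. \<eta> (x + h *\<^sub>R axis i 1) - \<eta> x - h * partial_deriv i \<eta> x"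
    \<comment> \<open>The subtracted term is zero by hypothesis; inserting it turns the integrand
      into \<open>u\<close> times a Taylor remainder.\<close>
    have "?T h - ?T 0 = ?T h - ?T 0 - h * (LINT x|lebesgue. u x * partial_deriv i \<eta> x)"
      by (simp add: 0 \<eta>)
    also have "\<dots> = (LINT x|lebesgue. u x * \<eta> (x + h *\<^sub>R axis i 1) - u x * \<eta> (x + 0 *\<^sub>R axis i 1)
        - h * (u x * partial_deriv i \<eta> x))"
      using int int' by (subst Bochner_Integration.integral_diff) (auto simp del: scaleR_zero_left)
    also have "\<dots> = (LINT x|lebesgue. u x * ?R x)"
      by (simp add: algebra_simps)
    finally have "?T h - ?T 0 = (LINT x|lebesgue. u x * ?R x)" .
    also have "\<bar>\<dots>\<bar> \<le> (LINT x|lebesgue. \<bar>u x * ?R x\<bar>)"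
      using integral_abs_bound by blast
    also have "\<dots> \<le> (LINT x|lebesgue. h\<^sup>2 * (indicator K x *\<^sub>R (M * \<bar>u x\<bar>)))"
    proof (rule integral_mono')
      show "integrable lebesgue (\<lambda>x. h\<^sup>2 * (indicator K x *\<^sub>R (M * \<bar>u x\<bar>)))"
        using Kint unfolding set_integrable_def by (rule integrable_mult_right)
      fix x
      show "\<bar>u x * ?R x\<bar> \<le> h\<^sup>2 * (indicator K x *\<^sub>R (M * \<bar>u x\<bar>))"
      proof (cases "x \<in> K")
        case True
        have "\<bar>u x\<bar> * \<bar>?R x\<bar> \<le> \<bar>u x\<bar> * (M * h\<^sup>2)"
          using line_taylor_bound[OF s M] by (rule mult_left_mono) auto
        with True show ?thesis by (simp add: abs_mult mult_ac)
      next
        case False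
        then have x: "r' < norm x" "r + 1 < norm x" by (auto simp: K_def)
        have "norm x \<le> norm (x + h *\<^sub>R axis i 1) + norm (h *\<^sub>R axis i 1 :: real^'n)"
          using norm_triangle_ineq4[of "x + h *\<^sub>R axis i 1" "h *\<^sub>R axis i 1"] by simp
        then have "r < norm (x + h *\<^sub>R axis i 1)"
          using x h by simp
        with x r r' False show ?thesis by simp
      qed
      show "0 \<le> h\<^sup>2 * (indicator K x *\<^sub>R (M * \<bar>u x\<bar>))"
        using M0 by simp
    qed
    also have "\<dots> = C * h\<^sup>2"
      unfolding C_def set_lebesgue_integral_def by (subst integral_mult_right_zero) (rule mult.commute)
    finally show ?thesis .
  qed
  have "((\<lambda>h. (?T (0 + h) - ?T 0) / h) \<longlongrightarrow> 0) (at 0)"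
  proof (rule Lim_null_comparison)
    show "((\<lambda>h. C * \<bar>h\<bar>) \<longlongrightarrow> 0) (at 0)"
      by (auto intro!: tendsto_eq_intros)
    have "\<forall>\<^sub>F h in at (0::real). h \<in> {-1<..<1} - {0}"
      by (intro eventually_at_in_open) auto
    then show "\<forall>\<^sub>F h in at 0. norm ((?T (0 + h) - ?T 0) / h) \<le> C * \<bar>h\<bar>"
    proof eventually_elim
      case (elim h)
      then have "\<bar>?T h - ?T 0\<bar> \<le> (C * \<bar>h\<bar>) * \<bar>h\<bar>"
        using bound[of h] by (auto simp: power2_eq_square mult.assoc simp flip: abs_mult)
      with elim show ?case by (simp add: divide_le_eq)
    qed
  qed
  then show ?thesis by (simp add: DERIV_def)
qed

text \<open>Along each axis the integral is a function of the shift with zero derivative, hence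
  constant. An arbitrary vector \<open>v\<close> is reached by moving along the coordinate axes one
  after another.\<close>

lemma shifted_integral_eq:
  fixes u :: "real^'n::finite \<Rightarrow> real"
  assumes u: "u \<in> L1_loc"
    and 0: "\<And>\<eta> i. \<eta> \<in> test_functions \<Longrightarrow> (LINT x|lebesgue. u x * partial_deriv i \<eta> x) = 0"
    and \<eta>: "\<eta> \<in> test_functions"
  shows "(LINT x|lebesgue. u x * \<eta> (x + v)) = (LINT x|lebesgue. u x * \<eta> x)"
proof -
  have axis: "(LINT x|lebesgue. u x * \<zeta> (x + t *\<^sub>R axis i 1)) = (LINT x|lebesgue. u x * \<zeta> x)"
    if \<zeta>: "\<zeta> \<in> test_functions" for \<zeta> t i
  proof -
    let ?T = "\<lambda>s. LINT x|lebesgue. u x * \<zeta> (x + s *\<^sub>R axis i 1)"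
    have "(?T has_real_derivative 0) (at t)" for t
    proof -
      \<comment> \<open>The derivative at \<open>t\<close> is the derivative at 0 for the translated
        test function.\<close>
      have "((\<lambda>s. ?T (s + t)) has_real_derivative 0) (at 0)"
        using shifted_integral_has_derivative_0[OF u 0 test_function_affine[OF \<zeta>, of 1 "t *\<^sub>R axis i 1"], of i]
        by (simp add: algebra_simps)
      then show ?thesis using DERIV_shift[of ?T 0 0 t] by simp
    qed
    then have "?T t = ?T 0" by (intro DERIV_isconst_all) blast
    then show ?thesis by simp
  qed
  \<comment> \<open>The test function stays arbitrary in the induction, since adding an axis
    replaces it by its translate along that axis.\<close>
  have "(LINT x|lebesgue. u x * \<zeta> (x + (\<Sum>i\<in>A. (v $ i) *\<^sub>R axis i 1))) = (LINT x|lebesgue. u x * \<zeta> x)"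
    if "\<zeta> \<in> test_functions" for \<zeta> and A :: "'n set"
    using finite[of A] that
  proof (induction A arbitrary: \<zeta> rule: finite_induct)
    case (insert j A)
    have "(\<lambda>x. \<zeta> (x + (v $ j) *\<^sub>R axis j 1)) \<in> test_functions"
      using test_function_affine[OF insert.prems, of 1 "(v $ j) *\<^sub>R axis j 1"] by simp
    from insert.IH[OF this] axis[OF insert.prems, of "v $ j" j] insert.hyps show ?case
      by (simp add: algebra_simps)
  qed simp
  from this[OF \<eta>, of UNIV] show ?thesis
    by (simp add: basis_expansion scalar_mult_eq_scaleR[symmetric])
qed

section \<open>Translation invariance of Lebesgue measure and constancy by Fubini\<close>

lemma lborel_integral_shift:
  fixes f :: "'a::euclidean_space \<Rightarrow> real"
  assumes "f \<in> borel_measurable borel"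
  shows "(LINT x|lborel. f (x + v)) = (LINT x|lborel. f x)"
  using integral_distr[of "(+) v" lborel borel f] assms by (simp add: lborel_distr_plus add.commute)

lemma lborel_integrable_shift:
  fixes f :: "'a::euclidean_space \<Rightarrow> real"
  assumes "f \<in> borel_measurable borel"
  shows "integrable lborel (\<lambda>x. f (x + v)) \<longleftrightarrow> integrable lborel f"
  using integrable_distr_eq[of "(+) v" lborel borel f] assms by (simp add: lborel_distr_plus add.commute)

lemma L1_loc_shift:
  fixes u :: "'a::euclidean_space \<Rightarrow> real"
  assumes u: "u \<in> L1_loc" and [measurable]: "u \<in> borel_measurable borel"
  shows "(\<lambda>x. u (x + v)) \<in> L1_loc"
proof -
  have "integrable lebesgue (\<lambda>x. indicator K x *\<^sub>R u (x + v))" if K: "compact K" for K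
  proof -
    let ?K = "(\<lambda>x. x + v) ` K"
    have "compact ?K"
      using K by (intro compact_continuous_image continuous_intros)
    then have [measurable]: "?K \<in> sets borel" "K \<in> sets borel"
      and "integrable lebesgue (\<lambda>x. indicator ?K x *\<^sub>R u x)"
      using K L1_locD[OF u, of ?K] by (auto simp: set_integrable_def borel_compact)
    then have "integrable lborel (\<lambda>x. indicator ?K x *\<^sub>R u x)"
      by (subst (asm) integrable_completion) auto
    then have "integrable lborel (\<lambda>x. indicator ?K (x + v) *\<^sub>R u (x + v))"
      by (subst lborel_integrable_shift[of "\<lambda>x. indicator ?K x *\<^sub>R u x"]) auto
    moreover have "indicator ?K (x + v) = (indicator K x :: real)" for x
      by (auto simp: indicator_def)
    ultimately show ?thesis
      by (subst integrable_completion) auto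
  qed
  moreover have "(\<lambda>x. u (x + v)) \<in> borel_measurable lebesgue"
    by (intro measurable_completion) simp
  ultimately show ?thesis
    by (simp add: L1_loc_def set_integrable_def)
qed

text \<open>For each \<open>v\<close>, moving the shift onto the test function and applying the
  fundamental lemma gives \<open>u (x + v) = u x\<close> for almost every \<open>x\<close>. The null
  set depends on \<open>v\<close>, so the quantifiers are exchanged by Fubini; Borel measurability
  of \<open>u\<close> makes the condition jointly measurable in \<open>x\<close> and
  \<open>v\<close>.\<close>

lemma AE_const_if_partial_derivs_zero_borel:
  fixes u :: "real^'n::finite \<Rightarrow> real"
  assumes u: "u \<in> L1_loc" and um[measurable]: "u \<in> borel_measurable borel"
    and 0: "\<And>\<eta> i. \<eta> \<in> test_functions \<Longrightarrow> (LINT x|lebesgue. u x * partial_deriv i \<eta> x) = 0"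
  shows "\<exists>c. AE x in lborel. u x = c"
proof -
  have shift: "AE x in lborel. u (x + v) = u x" for v
  proof -
    have uv: "(\<lambda>x. u (x + v)) \<in> L1_loc" by (rule L1_loc_shift[OF u um])
    have "AE x in lebesgue. u (x + v) - u x = 0"
    proof (rule fundamental_lemma_calculus_of_variations)
      show "(\<lambda>x. u (x + v) - u x) \<in> L1_loc"
        using u uv by (auto simp: L1_loc_def intro!: set_integral_diff)
      fix \<eta> :: "real^'n \<Rightarrow> real" assume \<eta>: "\<eta> \<in> test_functions"
      then have [measurable]: "\<eta> \<in> borel_measurable borel"
        by (rule_tac test_functionE[OF \<eta>], intro borel_measurable_continuous_onI smooth_continuous)
      have "(LINT x|lebesgue. (u (x + v) - u x) * \<eta> x)
          = (LINT x|lebesgue. u (x + v) * \<eta> x) - (LINT x|lebesgue. u x * \<eta> x)"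
        unfolding left_diff_distrib
        by (intro Bochner_Integration.integral_diff integrable_mult_test_function \<eta> L1_locD u uv)
      \<comment> \<open>Writing \<open>x\<close> as \<open>x + v - v\<close> makes the integrand a
        translate, so invariance moves the shift from \<open>u\<close> to
        \<open>\<eta>\<close>.\<close>
      also have "(LINT x|lebesgue. u (x + v) * \<eta> x) = (LINT x|lborel. u (x + v) * \<eta> (x + v - v))"
        by (subst integral_completion) auto
      also have "\<dots> = (LINT x|lborel. u x * \<eta> (x - v))"
        by (rule lborel_integral_shift) auto
      also have "\<dots> = (LINT x|lebesgue. u x * \<eta> (x + - v))"
        by (subst integral_completion) auto
      also have "\<dots> = (LINT x|lebesgue. u x * \<eta> x)"
        by (rule shifted_integral_eq[OF u 0 \<eta>])
      finally show "(LINT x|lebesgue. (u (x + v) - u x) * \<eta> x) = 0" by simp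
    qed
    then show ?thesis by (simp add: AE_completion_iff)
  qed
  have "(AE v in lborel. AE x in lborel. u (x + v) = u x) \<longleftrightarrow> (AE x in lborel. AE v in lborel. u (x + v) = u x)"
    by (rule lborel_pair.AE_commute) measurable
  with shift have "AE x in lborel. AE v in lborel. u (x + v) = u x" by simp
  \<comment> \<open>Lebesgue measure is not null, so a property that holds almost everywhere holds
    at some point; that \<open>x\<close> supplies the constant \<open>u x\<close>.\<close>
  moreover have "ae_filter (lborel :: (real^'n) measure) \<noteq> bot"
    by (simp add: ae_filter_eq_bot_iff)
  ultimately obtain x where "AE v in lborel. u (x + v) = u x"
    using eventually_happens by blast
  \<comment> \<open>Substitute \<open>y = x + v\<close>: the image of Lebesgue measure under
    translation by \<open>x\<close> is Lebesgue measure again.\<close>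
  then have "AE y in distr lborel borel ((+) x). u y = u x"
    by (subst AE_distr_iff) auto
  then show ?thesis unfolding lborel_distr_plus ..
qed

text \<open>Reduction to a Borel representative, which changes neither local integrability nor any
  of the integrals.\<close>

lemma AE_const_if_partial_derivs_zero:
  fixes u :: "real^'n::finite \<Rightarrow> real"
  assumes u: "u \<in> L1_loc"
    and 0: "\<And>\<eta> i. \<eta> \<in> test_functions \<Longrightarrow> (LINT x|lebesgue. u x * partial_deriv i \<eta> x) = 0"
  shows "\<exists>c. AE x in lebesgue. u x = c"
proof -
  have um: "u \<in> borel_measurable lebesgue"
    using u by (simp add: L1_loc_def)
  obtain g where g[measurable]: "g \<in> borel_measurable lborel" and "AE x in lborel. u x = g x"
    using completion_ex_borel_measurable_real[OF um] by auto
  then have ae: "AE x in lebesgue. u x = g x" by (intro AE_completion)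
  have gm: "g \<in> borel_measurable lebesgue"
    using g by (rule measurable_completion)
  have "g \<in> L1_loc"
    unfolding L1_loc_def mem_Collect_eq
  proof (intro conjI gm allI impI)
    fix K :: "(real^'n) set" assume "compact K"
    then have "K \<in> sets lebesgue" and "set_integrable lebesgue K u"
      using u by (auto simp: borel_compact intro: L1_locD)
    then show "set_integrable lebesgue K g"
      unfolding set_integrable_def
      by (rule_tac integrable_cong_AE_imp) (use ae gm in auto)
  qed
  moreover have "(LINT x|lebesgue. g x * partial_deriv i \<eta> x) = 0" if \<eta>: "\<eta> \<in> test_functions" for \<eta> i
  proof -
    have "partial_deriv i \<eta> \<in> borel_measurable lebesgue"
      by (rule test_functionE[OF \<eta>], intro smooth_lebesgue_measurable smooth_partial_deriv)
    then have "(LINT x|lebesgue. g x * partial_deriv i \<eta> x) = (LINT x|lebesgue. u x * partial_deriv i \<eta> x)"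
      using um gm ae by (intro integral_cong_AE) auto
    with 0[OF \<eta>] show ?thesis by simp
  qed
  ultimately obtain c where "AE x in lborel. g x = c"
    using AE_const_if_partial_derivs_zero_borel[of g] g by auto
  then have "AE x in lebesgue. g x = c" by (rule AE_completion)
  with ae have "AE x in lebesgue. u x = c" by eventually_elim simp
  then show ?thesis ..
qed

subsection \<open>Energy estimates\<close>

text \<open>The constants come from \<open>exp_inv 1 = exp (-1)\<close> and
  \<open>exp_inv 3 = exp (-1/3)\<close>. On the unit ball the inner \<open>exp_inv\<close> is 0, so
  the value is 1; for \<open>norm x \<ge> 2\<close> one has
  \<open>x \<bullet> x - 1 \<ge> 3\<close>, so the outer argument is at most 0 and the value is
  0.\<close>

definition cutoff :: "real^'n::finite \<Rightarrow> real" where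
  "cutoff x = exp 1 * exp_inv (1 - exp (1/3) * exp_inv (x \<bullet> x - 1))"

lemma smooth_cutoff: "smooth cutoff"
  unfolding cutoff_def[abs_def]
  by (intro smooth_mult smooth_exp_inv smooth_diff smooth_const smooth_inner_self)

lemma cutoff_nonneg: "0 \<le> cutoff x"
  by (simp add: cutoff_def exp_inv_nonneg)

lemma cutoff_le_1: "cutoff x \<le> 1"
proof -
  have "exp_inv (1 - exp (1/3) * exp_inv (x \<bullet> x - 1)) \<le> exp_inv 1"
    by (intro exp_inv_mono) (simp add: exp_inv_nonneg)
  then have "cutoff x \<le> exp 1 * exp_inv 1"
    unfolding cutoff_def by (intro mult_left_mono) auto
  then show ?thesis by (simp add: exp_inv_def flip: exp_add)
qed

lemma cutoff_eq_1: "norm x \<le> 1 \<Longrightarrow> cutoff x = 1"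
  by (simp add: cutoff_def exp_inv_def power_le_one flip: exp_add power2_norm_eq_inner)

lemma cutoff_eq_0:
  assumes "2 \<le> norm x"
  shows "cutoff x = 0"
proof -
  have "2\<^sup>2 \<le> (norm x)\<^sup>2" using assms by (intro power_mono) auto
  then have "exp_inv 3 \<le> exp_inv (x \<bullet> x - 1)"
    by (intro exp_inv_mono) (simp add: power2_norm_eq_inner)
  then have "exp (1/3) * exp_inv 3 \<le> exp (1/3) * exp_inv (x \<bullet> x - 1)"
    by (intro mult_left_mono) auto
  then have "1 - exp (1/3) * exp_inv (x \<bullet> x - 1) \<le> 0"
    by (simp add: exp_inv_def flip: exp_add)
  then show ?thesis by (simp add: cutoff_def exp_inv_def)
qed

lemma gradient_eq_0_if_locally_const:
  fixes f :: "real^'n::finite \<Rightarrow> real"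
  assumes "smooth f" "open X" "x \<in> X" "\<And>y. y \<in> X \<Longrightarrow> f y = c"
  shows "gradient f x = 0"
proof -
  have "frechet_derivative f (at x) = frechet_derivative (\<lambda>_. c) (at x)"
    using assms by (intro frechet_derivative_transform_within_open) (auto intro: smooth_differentiable)
  then show ?thesis by (simp add: gradient_def partial_deriv_def vec_eq_iff)
qed

text \<open>All radii use rescalings of the single profile \<open>cutoff\<close>, so one constant
  \<open>M\<close> serves every \<open>R\<close>, and each derivative gains the factor
  \<open>1 / R\<close>.\<close>

lemma scaled_cutoff_exists:
  obtains M where "0 \<le> M"
    and "\<forall>R>0. \<exists>\<psi> :: real^'n::finite \<Rightarrow> real. smooth \<psi> \<and> (\<forall>x. 0 \<le> \<psi> x \<and> \<psi> x \<le> 1)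
      \<and> (\<forall>x. norm x < R \<longrightarrow> \<psi> x = 1) \<and> (\<forall>x. 2 * R \<le> norm x \<longrightarrow> \<psi> x = 0)
      \<and> (\<forall>x. norm (gradient \<psi> x) \<le> M / R) \<and> (\<forall>x. norm x < R \<longrightarrow> gradient \<psi> x = 0)"
proof -
  have cut: "(cutoff :: real^'n \<Rightarrow> real) \<in> test_functions"
    by (rule test_functionI[OF smooth_cutoff, of 2]) (simp add: cutoff_eq_0)
  have "\<exists>B\<ge>0. \<forall>x. \<bar>partial_deriv i (cutoff :: real^'n \<Rightarrow> real) x\<bar> \<le> B" for i
    by (rule test_function_bounded[OF test_function_partial_deriv[OF cut, of i]]) blast
  then obtain B where B: "\<And>i. 0 \<le> B i" "\<And>i x. \<bar>partial_deriv i (cutoff :: real^'n \<Rightarrow> real) x\<bar> \<le> B i"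
    by metis
  define M where "M = (\<Sum>i\<in>UNIV. B i)"
  show ?thesis
  proof (rule that[of M])
    show "0 \<le> M" unfolding M_def using B by (intro sum_nonneg) auto
    show "\<forall>R>0. \<exists>\<psi> :: real^'n \<Rightarrow> real. smooth \<psi> \<and> (\<forall>x. 0 \<le> \<psi> x \<and> \<psi> x \<le> 1)
      \<and> (\<forall>x. norm x < R \<longrightarrow> \<psi> x = 1) \<and> (\<forall>x. 2 * R \<le> norm x \<longrightarrow> \<psi> x = 0)
      \<and> (\<forall>x. norm (gradient \<psi> x) \<le> M / R) \<and> (\<forall>x. norm x < R \<longrightarrow> gradient \<psi> x = 0)"
    proof (intro allI impI)
      fix R :: real assume R: "0 < R"
      define \<psi> :: "real^'n \<Rightarrow> real" where "\<psi> x = cutoff ((1 / R) *\<^sub>R x)" for x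
      have s: "smooth \<psi>"
        using smooth_affine[OF smooth_cutoff, of "1 / R" 0] by (simp add: \<psi>_def[abs_def])
      have one: "\<psi> x = 1" if "norm x < R" for x
        unfolding \<psi>_def using that R by (intro cutoff_eq_1) (simp add: field_simps)
      have zero: "\<psi> x = 0" if "2 * R \<le> norm x" for x
        unfolding \<psi>_def using that R by (intro cutoff_eq_0) (simp add: field_simps)
      have pd: "\<bar>partial_deriv i \<psi> x\<bar> \<le> B i / R" for i x
      proof -
        have "partial_deriv i \<psi> x = (1 / R) * partial_deriv i cutoff ((1 / R) *\<^sub>R x)"
          using partial_deriv_affine[OF smooth_differentiable[OF smooth_cutoff], where c = "1 / R" and x = x and v = 0 and i = i]
          by (simp add: \<psi>_def[abs_def])
        then show ?thesis
          using B(2)[of i] R by (simp add: abs_mult divide_right_mono)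
      qed
      have "norm (gradient \<psi> x) \<le> M / R" for x
      proof -
        have "norm (gradient \<psi> x) \<le> (\<Sum>i\<in>UNIV. \<bar>gradient \<psi> x $ i\<bar>)"
          by (rule norm_le_l1_cart)
        also have "\<dots> \<le> (\<Sum>i\<in>UNIV. B i / R)"
          by (intro sum_mono) (simp add: gradient_def pd)
        finally show ?thesis by (simp add: M_def sum_divide_distrib)
      qed
      moreover have "gradient \<psi> x = 0" if "norm x < R" for x
        by (rule gradient_eq_0_if_locally_const[OF s open_ball, of _ 0 R 1]) (use that one in auto)
      moreover have "0 \<le> \<psi> x \<and> \<psi> x \<le> 1" for x
        by (simp add: \<psi>_def cutoff_nonneg cutoff_le_1)
      ultimately show "\<exists>\<psi> :: real^'n \<Rightarrow> real. smooth \<psi> \<and> (\<forall>x. 0 \<le> \<psi> x \<and> \<psi> x \<le> 1)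
        \<and> (\<forall>x. norm x < R \<longrightarrow> \<psi> x = 1) \<and> (\<forall>x. 2 * R \<le> norm x \<longrightarrow> \<psi> x = 0)
        \<and> (\<forall>x. norm (gradient \<psi> x) \<le> M / R) \<and> (\<forall>x. norm x < R \<longrightarrow> gradient \<psi> x = 0)"
        using s one zero by (intro exI[of _ \<psi>]) blast
    qed
  qed
qed

lemma gradient_square:
  assumes "smooth \<psi>"
  shows "gradient (\<lambda>x. (\<psi> x)\<^sup>2) x = (2 * \<psi> x) *\<^sub>R gradient \<psi> x"
proof -
  have "partial_deriv i (\<lambda>x. (\<psi> x)\<^sup>2) x = 2 * \<psi> x * partial_deriv i \<psi> x" for i
    using partial_deriv_mult[of \<psi> x \<psi> i] smooth_differentiable[OF assms]
    by (simp add: power2_eq_square)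
  then show ?thesis by (simp add: gradient_def vec_eq_iff)
qed

section \<open>Weighted energy on balls and annuli\<close>

lemma gradient_lebesgue_measurable:
  assumes "smooth f"
  shows "gradient f \<in> borel_measurable lebesgue"
proof -
  have "continuous_on UNIV (gradient f)"
    unfolding gradient_def[abs_def]
    by (intro continuous_on_vec_lambda smooth_continuous smooth_partial_deriv assms)
  then show ?thesis
    by (intro measurable_completion) (simp add: borel_measurable_continuous_onI)
qed

lemma set_integrable_Linf_square_mult:
  fixes \<phi> f :: "'a::euclidean_space \<Rightarrow> real"
  assumes \<phi>: "\<phi> \<in> Linf_loc" and K: "compact K" and f: "set_integrable lebesgue K f"
  shows "set_integrable lebesgue K (\<lambda>x. (\<phi> x)\<^sup>2 * f x)"
proof -
  have \<phi>m: "\<phi> \<in> borel_measurable lebesgue"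
    using \<phi> by (simp add: Linf_loc_def)
  from \<phi> K obtain C where C: "AE x in lebesgue. x \<in> K \<longrightarrow> \<bar>\<phi> x\<bar> \<le> C"
    unfolding Linf_loc_def by auto
  have int: "integrable lebesgue (\<lambda>x. C\<^sup>2 * (indicator K x *\<^sub>R f x))"
    using f unfolding set_integrable_def by (rule integrable_mult_right)
  have "integrable lebesgue (\<lambda>x. (\<phi> x)\<^sup>2 * (indicator K x *\<^sub>R f x))"
  proof (rule Bochner_Integration.integrable_bound[OF int])
    show "(\<lambda>x. (\<phi> x)\<^sup>2 * (indicator K x *\<^sub>R f x)) \<in> borel_measurable lebesgue"
      using f \<phi>m unfolding set_integrable_def by (intro borel_measurable_times borel_measurable_power) auto
    show "AE x in lebesgue. norm ((\<phi> x)\<^sup>2 * (indicator K x *\<^sub>R f x)) \<le> norm (C\<^sup>2 * (indicator K x *\<^sub>R f x))"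
      using C
    proof eventually_elim
      case (elim x)
      then show ?case
        using power_mono[of "\<bar>\<phi> x\<bar>" C 2] by (cases "x \<in> K") (auto simp: abs_mult mult_right_mono)
    qed
  qed
  then show ?thesis
    by (simp add: set_integrable_def mult.left_commute)
qed

lemma set_integrable_bounded_mult:
  fixes f h :: "'a \<Rightarrow> real"
  assumes f: "set_integrable M S f" and h: "h \<in> borel_measurable M" and "\<And>x. \<bar>h x\<bar> \<le> 1"
  shows "set_integrable M S (\<lambda>x. f x * h x)"
  unfolding set_integrable_def
proof (rule Bochner_Integration.integrable_bound[OF f[unfolded set_integrable_def]])
  have "(\<lambda>x. (indicator S x *\<^sub>R f x) * h x) \<in> borel_measurable M"
    using f h unfolding set_integrable_def by (intro borel_measurable_times) auto
  then show "(\<lambda>x. indicator S x *\<^sub>R (f x * h x)) \<in> borel_measurable M"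
    by (simp add: mult.assoc)
  show "AE x in M. norm (indicator S x *\<^sub>R (f x * h x)) \<le> norm (indicator S x *\<^sub>R f x)"
    using assms(3) by (auto simp: abs_mult mult_left_le indicator_def)
qed

text \<open>Expand \<open>(t * (b * a) - M * \<bar>s\<bar>)\<^sup>2 / t \<ge> 0\<close>. In the
  application \<open>s\<close> is \<open>\<sigma> x\<close>, \<open>a\<close> is
  \<open>\<psi> x\<close>, \<open>b\<close> and \<open>d\<close> are the norms of \<open>G x\<close>
  and of the gradient of \<open>\<psi>\<close>, and \<open>c\<close> is their inner product.\<close>

lemma weighted_young_inequality:
  fixes s a b c M t :: real
  assumes "0 < t" "\<bar>c\<bar> \<le> b * d" "0 \<le> d" "d \<le> M" "0 \<le> b" "0 \<le> a"
  shows "\<bar>s * (2 * a * c)\<bar> \<le> t * (b\<^sup>2 * a\<^sup>2) + M\<^sup>2 / t * s\<^sup>2"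
proof -
  have "b * d \<le> b * M" using assms by (intro mult_left_mono) auto
  then have "\<bar>c\<bar> \<le> b * M" using assms by linarith
  then have "(2 * \<bar>s\<bar> * a) * \<bar>c\<bar> \<le> (2 * \<bar>s\<bar> * a) * (b * M)"
    using assms by (intro mult_left_mono) auto
  also have "\<dots> \<le> t * (b\<^sup>2 * a\<^sup>2) + M\<^sup>2 / t * s\<^sup>2"
  proof -
    have "0 \<le> (t * (b * a) - M * \<bar>s\<bar>)\<^sup>2 / t" using assms by simp
    also have "\<dots> = t * (b\<^sup>2 * a\<^sup>2) + M\<^sup>2 / t * s\<^sup>2 - (2 * \<bar>s\<bar> * a) * (b * M)"
      using assms by (simp add: field_simps power2_eq_square)
    finally show ?thesis by simp
  qed
  finally show ?thesis using assms by (simp add: abs_mult mult_ac)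
qed

text \<open>The cross term produced by the gradient of the squared cutoff lives on the annulus and
  is bounded there pointwise by Young's inequality. Keeping the \<open>t\<close> term on the annulus
  is essential: it later becomes an increment of the energy.\<close>

lemma local_energy_estimate:
  fixes \<phi> \<sigma> \<psi> :: "real^'n::finite \<Rightarrow> real" and G :: "real^'n \<Rightarrow> real^'n"
  defines "A \<equiv> \<lambda>R. ball 0 (2 * R) - ball 0 R :: (real^'n) set"
  assumes \<phi>: "\<phi> \<in> Linf_loc" and \<sigma>: "\<sigma> \<in> L2_loc" and G: "G \<in> L2_loc"
    and s: "smooth \<psi>" and \<psi>: "\<And>x. 0 \<le> \<psi> x" "\<And>x. \<psi> x \<le> 1"
    and supp: "\<And>x. 2 * R \<le> norm x \<Longrightarrow> \<psi> x = 0"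
    and grad: "\<And>x. norm (gradient \<psi> x) \<le> M" "\<And>x. norm x < R \<Longrightarrow> gradient \<psi> x = 0"
    and t: "0 < t"
  shows "(LINT x|lebesgue. (\<phi> x)\<^sup>2 * (norm (G x))\<^sup>2 * (\<psi> x)\<^sup>2)
    \<le> (LINT x|lebesgue. (\<phi> x)\<^sup>2 * ((norm (G x))\<^sup>2 * (\<psi> x)\<^sup>2 + \<sigma> x * (G x \<bullet> gradient (\<lambda>x. (\<psi> x)\<^sup>2) x)))
      + t * (LINT x:A R|lebesgue. (\<phi> x)\<^sup>2 * (norm (G x))\<^sup>2 * (\<psi> x)\<^sup>2)
      + M\<^sup>2 / t * (LINT x:A R|lebesgue. (\<phi> x)\<^sup>2 * (\<sigma> x)\<^sup>2)"
proof -
  let ?K = "cball 0 (2 * R) :: (real^'n) set"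
  let ?e = "\<lambda>x. (\<phi> x)\<^sup>2 * (norm (G x))\<^sup>2 * (\<psi> x)\<^sup>2"
  let ?c = "\<lambda>x. (\<phi> x)\<^sup>2 * (\<sigma> x * (G x \<bullet> gradient (\<lambda>x. (\<psi> x)\<^sup>2) x))"
  let ?r = "\<lambda>x. t * (indicator (A R) x *\<^sub>R ?e x) + M\<^sup>2 / t * (indicator (A R) x *\<^sub>R ((\<phi> x)\<^sup>2 * (\<sigma> x)\<^sup>2))"
  have m: "\<phi> \<in> borel_measurable lebesgue" "\<sigma> \<in> borel_measurable lebesgue" "G \<in> borel_measurable lebesgue"
      "\<psi> \<in> borel_measurable lebesgue"
    using \<phi> \<sigma> G smooth_lebesgue_measurable[OF s] by (simp_all add: Linf_loc_def L2_loc_def)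
  have gm: "gradient (\<lambda>x. (\<psi> x)\<^sup>2) \<in> borel_measurable lebesgue"
    unfolding power2_eq_square by (intro gradient_lebesgue_measurable smooth_mult s)
  have A: "A R \<in> sets lebesgue" "A R \<subseteq> ?K"
    by (auto simp: A_def)
  have eK: "set_integrable lebesgue ?K ?e"
  proof (rule set_integrable_bounded_mult)
    show "set_integrable lebesgue ?K (\<lambda>x. (\<phi> x)\<^sup>2 * (norm (G x))\<^sup>2)"
      using G by (intro set_integrable_Linf_square_mult \<phi>) (auto simp: L2_loc_def)
    show "(\<lambda>x. (\<psi> x)\<^sup>2) \<in> borel_measurable lebesgue" by (intro borel_measurable_power m)
    show "\<bar>(\<psi> x)\<^sup>2\<bar> \<le> 1" for x using \<psi>[of x] by (simp add: power_le_one)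
  qed
  have bK: "set_integrable lebesgue ?K (\<lambda>x. (\<phi> x)\<^sup>2 * (\<sigma> x)\<^sup>2)"
    using \<sigma> by (intro set_integrable_Linf_square_mult \<phi>) (auto simp: L2_loc_def)
  have eA: "integrable lebesgue (\<lambda>x. indicator (A R) x *\<^sub>R ?e x)"
    and bA: "integrable lebesgue (\<lambda>x. indicator (A R) x *\<^sub>R ((\<phi> x)\<^sup>2 * (\<sigma> x)\<^sup>2))"
    using set_integrable_subset[OF eK A] set_integrable_subset[OF bK A] by (simp_all add: set_integrable_def)
  have e0: "indicator ?K x *\<^sub>R ?e x = ?e x" for x
    using supp[of x] by (auto simp: indicator_def)
  have e: "integrable lebesgue ?e"
    using eK by (simp only: set_integrable_def e0)
  have r: "integrable lebesgue ?r"
    by (intro Bochner_Integration.integrable_add integrable_mult_right eA bA)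
  \<comment> \<open>Off the annulus both sides vanish: inside the small ball the gradient of
    \<open>\<psi>\<close> is 0, and outside the large ball \<open>\<psi>\<close> is 0.\<close>
  have pt: "\<bar>?c x\<bar> \<le> ?r x" for x
  proof (cases "x \<in> A R")
    case True
    have "\<bar>\<sigma> x * (2 * \<psi> x * (G x \<bullet> gradient \<psi> x))\<bar> \<le> t * ((norm (G x))\<^sup>2 * (\<psi> x)\<^sup>2) + M\<^sup>2 / t * (\<sigma> x)\<^sup>2"
      by (rule weighted_young_inequality[OF t Cauchy_Schwarz_ineq2 _ grad(1)]) (auto simp: \<psi>)
    then have "(\<phi> x)\<^sup>2 * \<bar>\<sigma> x * (2 * \<psi> x * (G x \<bullet> gradient \<psi> x))\<bar>
        \<le> (\<phi> x)\<^sup>2 * (t * ((norm (G x))\<^sup>2 * (\<psi> x)\<^sup>2) + M\<^sup>2 / t * (\<sigma> x)\<^sup>2)"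
      by (rule mult_left_mono) simp
    with True show ?thesis
      by (simp add: gradient_square[OF s] abs_mult algebra_simps)
  next
    case False
    then have "norm x < R \<or> 2 * R \<le> norm x" by (auto simp: A_def)
    with False show ?thesis
      using supp[of x] grad(2)[of x] by (auto simp: gradient_square[OF s])
  qed
  \<comment> \<open>The pointwise bound \<open>pt\<close> also gives integrability of the cross
    term.\<close>
  have c: "integrable lebesgue ?c"
  proof (rule Bochner_Integration.integrable_bound[OF r])
    show "?c \<in> borel_measurable lebesgue"
      by (intro borel_measurable_times borel_measurable_power borel_measurable_inner m gm)
    show "AE x in lebesgue. norm (?c x) \<le> norm (?r x)"
    proof (rule AE_I2)
      fix x show "norm (?c x) \<le> norm (?r x)"
        using order_trans[OF pt[of x] abs_ge_self] by (simp only: real_norm_def)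
    qed
  qed
  have "(LINT x|lebesgue. ?e x) \<le> (LINT x|lebesgue. (?e x + ?c x) + ?r x)"
  proof (rule integral_mono)
    show "?e x \<le> (?e x + ?c x) + ?r x" for x
      using pt[of x] by linarith
  qed (intro e c r Bochner_Integration.integrable_add)+
  also have "\<dots> = (LINT x|lebesgue. ?e x + ?c x) + (LINT x|lebesgue. ?r x)"
    by (intro Bochner_Integration.integral_add Bochner_Integration.integrable_add e c r)
  also have "(LINT x|lebesgue. ?r x) = t * (LINT x:A R|lebesgue. ?e x) + M\<^sup>2 / t * (LINT x:A R|lebesgue. (\<phi> x)\<^sup>2 * (\<sigma> x)\<^sup>2)"
    unfolding set_lebesgue_integral_def
    by (simp only: Bochner_Integration.integral_add[OF integrable_mult_right[OF eA] integrable_mult_right[OF bA]]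
        integral_mult_right_zero)
  finally show ?thesis
    by (simp add: distrib_left mult.assoc)
qed

section \<open>Discrete growth argument and the dyadic form of the divergence condition\<close>

text \<open>The bound \<open>ub\<close> is needed at those \<open>k\<close> where \<open>D\<close> more than doubles: there \<open>step\<close> alone does not
  control \<open>1 / D k - 1 / D (Suc k)\<close> from below.\<close>

lemma zero_if_reciprocals_not_summable:
  fixes D f :: "nat \<Rightarrow> real"
  assumes C: "0 < C" and f: "\<And>k. 0 < f k" and D: "\<And>k. 0 \<le> D k"
    and ub: "\<And>k. N \<le> k \<Longrightarrow> D k \<le> C * f k"
    and step: "\<And>k. N \<le> k \<Longrightarrow> (D k)\<^sup>2 \<le> C * f k * (D (Suc k) - D k)"
    and div: "\<not> summable (\<lambda>k. 1 / f k)"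
    and n: "N \<le> n"
  shows "D n = 0"
proof (rule ccontr)
  assume "D n \<noteq> 0"
  with D[of n] have n0: "0 < D n" by simp
  have mono: "D k \<le> D (Suc k)" if "N \<le> k" for k
  proof -
    have "0 \<le> C * f k * (D (Suc k) - D k)"
      using step[OF that] zero_le_power2[of "D k"] by linarith
    then show ?thesis
      using zero_le_mult_iff[of "C * f k" "D (Suc k) - D k"] mult_pos_pos[OF C f[of k]] by linarith
  qed
  have pos: "0 < D (k + n)" for k
    by (induction k) (use n0 n mono in \<open>auto intro: less_le_trans\<close>)
  have dec: "1 / (2 * C * f (k + n)) \<le> 1 / D (k + n) - 1 / D (Suc k + n)" for k
  proof -
    define d d' c where "d = D (k + n)" and "d' = D (Suc k + n)" and "c = C * f (k + n)"
    have p: "0 < d" "0 < d'" "0 < c"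
      using pos[of k] pos[of "Suc k"] C f[of "k + n"] by (auto simp: d_def d'_def c_def)
    have u: "d \<le> c" and st: "d\<^sup>2 \<le> c * (d' - d)"
      using ub[of "k + n"] step[of "k + n"] n by (auto simp: d_def d'_def c_def)
    have "1 / (2 * c) \<le> 1 / d - 1 / d'"
    proof (cases "d' \<le> 2 * d")
      case True
      \<comment> \<open>When \<open>D\<close> at most doubles,
        \<open>d * d' \<le> 2 * c * (d' - d)\<close>; dividing by \<open>2 * c * d * d'\<close>
        gives the claim.\<close>
      have "d * d' \<le> 2 * d\<^sup>2"
        using mult_left_mono[OF True, of d] p by (simp add: power2_eq_square)
      also have "\<dots> \<le> 2 * c * (d' - d)" using st by simp
      finally show ?thesis using p by (simp add: field_simps)
    next
      case False
      have "1 / (2 * c) \<le> 1 / (2 * d)" using u p by (intro divide_left_mono) auto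
      also have "\<dots> \<le> 1 / d - 1 / d'" using False p by (simp add: field_simps)
      finally show ?thesis .
    qed
    then show ?thesis by (simp add: d_def d'_def c_def mult.assoc)
  qed
  have "summable (\<lambda>k. 1 / (2 * C * f (k + n)))"
  proof (rule summableI_nonneg_bounded)
    show "0 \<le> 1 / (2 * C * f (k + n))" for k
      using C f[of "k + n"] by simp
    fix m
    have "(\<Sum>k<m. 1 / (2 * C * f (k + n))) \<le> (\<Sum>k<m. 1 / D (k + n) - 1 / D (Suc k + n))"
      by (intro sum_mono dec)
    also have "\<dots> = 1 / D n - 1 / D (m + n)"
      using sum_lessThan_telescope'[of "\<lambda>k. 1 / D (k + n)" m] by simp
    also have "\<dots> \<le> 1 / D n" using pos[of m] by simp
    finally show "(\<Sum>k<m. 1 / (2 * C * f (k + n))) \<le> 1 / D n" .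
  qed
  then have "summable (\<lambda>k. (2 * C) * (1 / (2 * C * f (k + n))))"
    by (rule summable_mult)
  then have "summable (\<lambda>k. 1 / f (k + n))" using C by simp
  then have "summable (\<lambda>k. 1 / f k)"
    by (subst (asm) summable_iff_shift)
  with div show False ..
qed

lemma real_dyadic_interval:
  assumes "1 \<le> (r::real)"
  obtains k where "2 ^ k \<le> r" "r < 2 ^ Suc k"
proof -
  define n where "n = (LEAST n. r < 2 ^ n)"
  obtain n' where "r < 2 ^ n'" using real_arch_pow[of 2 r] by auto
  then have n: "r < 2 ^ n" unfolding n_def by (rule LeastI)
  \<comment> \<open>The case \<open>n = 0\<close> would say \<open>r < 1\<close>.\<close>
  then obtain k where k: "n = Suc k" using assms by (cases n) auto
  then have "2 ^ k \<le> r"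
    using not_less_Least[of k "\<lambda>n. r < 2 ^ n"] by (auto simp: n_def[symmetric])
  with n k that show ?thesis by blast
qed

text \<open>Cauchy condensation: since \<open>F\<close> is nondecreasing, on
  \<open>{2 ^ k..<2 ^ Suc k}\<close> the integrand is at most
  \<open>1 / (2 ^ k * F (2 ^ k))\<close>, and the interval has length \<open>2 ^ k\<close>.
  Summability would therefore make the integral finite.\<close>

lemma class_F_not_summable:
  assumes F: "F \<in> class_F"
  shows "\<not> summable (\<lambda>k. 1 / F (2 ^ k))"
proof
  assume sum: "summable (\<lambda>k. 1 / F (2 ^ k))"
  have pos: "\<And>r. 0 < r \<Longrightarrow> 0 < F r" and mono: "mono_on {0<..} F"
    and inf: "(\<integral>\<^sup>+ r\<in>{2..}. ennreal (1 / (r * F r)) \<partial>lborel) = \<infinity>"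
    using F by (auto simp: class_F_def)
  let ?g = "\<lambda>k (r::real). ennreal (1 / (2 ^ k * F (2 ^ k))) * indicator {2 ^ k..<2 ^ Suc k} r"
  have "ennreal (1 / (r * F r)) * indicator {2..} r \<le> (\<Sum>k. ?g k r)" for r
  proof (cases "2 \<le> r")
    case True
    then have "1 \<le> r" by simp
    then obtain k where k: "2 ^ k \<le> r" "r < 2 ^ Suc k" by (rule real_dyadic_interval)
    have k0: "(0::real) < 2 ^ k" by simp
    have "2 ^ k * F (2 ^ k) \<le> r * F r"
      using k True pos[OF k0] by (intro mult_mono mono_onD[OF mono]) auto
    then have "1 / (r * F r) \<le> 1 / (2 ^ k * F (2 ^ k))"
      using pos[OF k0] pos[of r] True by (intro divide_left_mono) auto
    then have "ennreal (1 / (r * F r)) * indicator {2..} r \<le> ?g k r"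
      using k by (auto simp: indicator_def intro: ennreal_leI)
    also have "\<dots> = (\<Sum>k\<in>{k}. ?g k r)"
      by (simp only: sum.insert sum.empty finite.emptyI empty_iff not_False_eq_True add_0_right)
    also have "\<dots> \<le> (\<Sum>k. ?g k r)"
      by (intro sum_le_suminf summableI) auto
    finally show ?thesis .
  qed simp
  then have "(\<integral>\<^sup>+ r\<in>{2..}. ennreal (1 / (r * F r)) \<partial>lborel) \<le> (\<integral>\<^sup>+ r. (\<Sum>k. ?g k r) \<partial>lborel)"
    by (intro nn_integral_mono)
  also have "\<dots> = (\<Sum>k. \<integral>\<^sup>+ r. ?g k r \<partial>lborel)"
    by (intro nn_integral_suminf) auto
  also have "\<dots> = (\<Sum>k. ennreal (1 / F (2 ^ k)))"
  proof (intro suminf_cong)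
    fix k :: nat
    have "(\<integral>\<^sup>+ r. ?g k r \<partial>lborel) = ennreal (1 / (2 ^ k * F (2 ^ k))) * ennreal (2 ^ k)"
      by (subst nn_integral_cmult_indicator) auto
    also have "\<dots> = ennreal (1 / F (2 ^ k))"
      using pos[of "2 ^ k"] by (simp flip: ennreal_mult')
    finally show "(\<integral>\<^sup>+ r. ?g k r \<partial>lborel) = ennreal (1 / F (2 ^ k))" .
  qed
  also have "\<dots> = ennreal (\<Sum>k. 1 / F (2 ^ k))"
    using sum pos by (intro suminf_ennreal_eq summable_sums) (auto intro: less_imp_le)
  finally show False using inf by (simp add: top_unique)
qed

text \<open>Optimisation over the free parameter. The choice \<open>t = 1/2\<close> absorbs
  \<open>EA\<close> into \<open>E\<close> and gives the linear bound;
  \<open>t = E / (2 * EA)\<close> gives the quadratic one.\<close>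

lemma quadratic_bounds_of_young:
  fixes E EA G D1 D2 :: real
  assumes young: "\<And>t. 0 < t \<Longrightarrow> E \<le> t * EA + G / t"
    and "0 \<le> EA" "EA \<le> E" "EA \<le> D2 - D1" "0 \<le> D1" "D1 \<le> E" "0 \<le> G" "G \<le> G'"
  shows "D1 \<le> 4 * G'" and "D1\<^sup>2 \<le> 4 * G' * (D2 - D1)"
proof -
  have E: "E \<le> 4 * G" using young[of "1/2"] assms by simp
  then show "D1 \<le> 4 * G'" using assms by linarith
  have "E\<^sup>2 \<le> 4 * G * EA"
  proof (cases "EA = 0")
    case True
    \<comment> \<open>With \<open>EA = 0\<close> the parameter can be sent to infinity. The summand
      1 in \<open>(G + 1) / e\<close> keeps it positive when \<open>G = 0\<close>.\<close>
    have "E \<le> 0 + e" if "0 < e" for e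
    proof -
      have "E \<le> G / ((G + 1) / e)" using young[of "(G + 1) / e"] True that assms by simp
      also have "\<dots> \<le> e" using that assms by (simp add: field_simps)
      finally show ?thesis by simp
    qed
    then have "E \<le> 0" by (rule field_le_epsilon)
    then have "E = 0" using assms by linarith
    with True show ?thesis by simp
  next
    case False
    then have EA: "0 < EA" "0 < E" using assms by auto
    have "E \<le> E / (2 * EA) * EA + G / (E / (2 * EA))"
      using EA by (intro young) simp
    also have "\<dots> = E / 2 + 2 * G * EA / E" using EA by simp
    finally have "E / 2 \<le> 2 * G * EA / E" by simp
    then show ?thesis using EA by (simp add: field_simps power2_eq_square)
  qed
  also have "\<dots> \<le> 4 * G' * (D2 - D1)"
    using assms by (intro mult_mono) auto
  finally show "D1\<^sup>2 \<le> 4 * G' * (D2 - D1)"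
    using power_mono[of D1 E 2] assms by linarith
qed

lemma Limsup_less_infinity_bound:
  fixes f :: "'a \<Rightarrow> real"
  assumes "Limsup F (\<lambda>x. ereal (f x)) < \<infinity>"
  obtains K where "0 < K" "\<forall>\<^sub>F x in F. f x \<le> K"
proof -
  have "Limsup F (\<lambda>x. ereal (f x)) \<noteq> \<infinity>" using assms by (rule less_imp_neq)
  then obtain k :: nat where k: "Limsup F (\<lambda>x. ereal (f x)) < ereal (real k)"
    unfolding less_PInf_Ex_of_nat ..
  have "\<forall>\<^sub>F x in F. f x \<le> max 1 (real k)"
    using Limsup_lessD[OF k] by eventually_elim simp
  then show ?thesis by (intro that[of "max 1 (real k)"]) auto
qed

section \<open>Weak gradients and the conclusion\<close>

lemma H1_locD:
  assumes "u \<in> H1_loc"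
  shows "u \<in> L2_loc" and "weak_gradient u \<in> L2_loc" and "has_weak_gradient u (weak_gradient u)"
proof -
  from assms have u: "u \<in> L2_loc" "\<exists>G. has_weak_gradient u G" "weak_gradient u \<in> L2_loc"
    unfolding H1_loc_def by blast+
  show "u \<in> L2_loc" "weak_gradient u \<in> L2_loc" by fact+
  show "has_weak_gradient u (weak_gradient u)"
    unfolding weak_gradient_def using u(2) by (rule someI_ex)
qed

lemma AE_const_if_weak_gradient_zero:
  assumes u: "has_weak_gradient u G" and G: "AE x in lebesgue. G x = 0"
  shows "\<exists>c. AE x in lebesgue. u x = c"
proof (rule AE_const_if_partial_derivs_zero)
  show "u \<in> L1_loc" using u by (simp add: has_weak_gradient_def)
  fix \<eta> :: "real^'a \<Rightarrow> real" and i assume "\<eta> \<in> test_functions"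
  then have "(LINT x|lebesgue. u x * partial_deriv i \<eta> x) = - (LINT x|lebesgue. G x $ i * \<eta> x)"
    using u by (simp add: has_weak_gradient_def)
  also have "(LINT x|lebesgue. G x $ i * \<eta> x) = 0"
    by (rule integral_eq_zero_AE) (use G in \<open>eventually_elim, simp\<close>)
  finally show "(LINT x|lebesgue. u x * partial_deriv i \<eta> x) = 0" by simp
qed

theorem theorem3p1:
  fixes m :: nat
    and \<phi> \<sigma> :: "nat \<Rightarrow> real^'n::finite \<Rightarrow> real"
    and F :: "real \<Rightarrow> real"
  assumes "m \<ge> 1"
    and "\<And>i. i \<in> {1..m} \<Longrightarrow> \<phi> i \<in> Linf_loc"
    and "\<And>i. i \<in> {1..m} \<Longrightarrow>
           (AE x in lebesgue. \<phi> i x > 0) \<or> (AE x in lebesgue. \<phi> i x < 0)"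
    and "\<And>i. i \<in> {1..m} \<Longrightarrow> \<sigma> i \<in> H1_loc"
    and "F \<in> class_F"
    and "Limsup at_top (\<lambda>R::real. ereal (1 / (R\<^sup>2 * F R) *
           (\<Sum>i=1..m. LINT x:(ball 0 (2 * R) - ball 0 R)|lebesgue. (\<phi> i x)\<^sup>2 * (\<sigma> i x)\<^sup>2))) < \<infinity>"
    and "weak_div_ineq m \<phi> \<sigma>"
  shows "\<forall>i\<in>{1..m}. \<exists>c. AE x in lebesgue. \<sigma> i x = c"
proof -
  note \<phi> = assms(2) and \<sigma> = assms(4)
  have F0: "\<And>r. 0 < r \<Longrightarrow> 0 < F r" using assms(5) by (auto simp: class_F_def)
  define G where "G i = weak_gradient (\<sigma> i)" for i
  have \<sigma>2: "\<sigma> i \<in> L2_loc" and G2: "G i \<in> L2_loc" if "i \<in> {1..m}" for i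
    using H1_locD[OF \<sigma>[OF that]] by (simp_all add: G_def)
  define g where "g i x = (\<phi> i x)\<^sup>2 * (norm (G i x))\<^sup>2" for i x
  define B where "B r = (ball 0 r :: (real^'n) set)" for r
  define A where "A r = B (2 * r) - B r" for r
  define D where "D k = (\<Sum>i=1..m. LINT x:B (2 ^ k)|lebesgue. g i x)" for k :: nat
  define S where "S r = (\<Sum>i=1..m. LINT x:A r|lebesgue. (\<phi> i x)\<^sup>2 * (\<sigma> i x)\<^sup>2)" for r
  have g_int: "set_integrable lebesgue (B r) (g i)" if i: "i \<in> {1..m}" for i r
  proof (rule set_integrable_subset)
    show "set_integrable lebesgue (cball 0 r) (g i)"
      unfolding g_def[abs_def] using G2[OF i]
      by (intro set_integrable_Linf_square_mult \<phi> i) (auto simp: L2_loc_def)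
  qed (auto simp: B_def)
  have S0: "0 \<le> S r" for r
    unfolding S_def set_lebesgue_integral_def by (intro sum_nonneg integral_nonneg) auto
  have D0: "0 \<le> D k" for k
    unfolding D_def set_lebesgue_integral_def g_def by (intro sum_nonneg integral_nonneg) auto

  obtain M where M0: "0 \<le> M" and cutoffs: "\<forall>R>0. \<exists>\<psi> :: real^'n \<Rightarrow> real. smooth \<psi> \<and> (\<forall>x. 0 \<le> \<psi> x \<and> \<psi> x \<le> 1)
      \<and> (\<forall>x. norm x < R \<longrightarrow> \<psi> x = 1) \<and> (\<forall>x. 2 * R \<le> norm x \<longrightarrow> \<psi> x = 0)
      \<and> (\<forall>x. norm (gradient \<psi> x) \<le> M / R) \<and> (\<forall>x. norm x < R \<longrightarrow> gradient \<psi> x = 0)"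
    by (rule scaled_cutoff_exists)
  obtain K where K: "0 < K"
    and "\<forall>\<^sub>F R in at_top. 1 / (R\<^sup>2 * F R) * S R \<le> K"
    by (rule Limsup_less_infinity_bound[OF assms(6)]) (simp add: S_def A_def B_def)
  then obtain R0 where R0: "\<And>R. R0 \<le> R \<Longrightarrow> 1 / (R\<^sup>2 * F R) * S R \<le> K"
    by (auto simp: eventually_at_top_linorder)
  \<comment> \<open>From index \<open>N\<close> on, every radius \<open>2 ^ k\<close> lies in the
    range where the growth bound holds.\<close>
  obtain N where N: "R0 < 2 ^ N" using real_arch_pow[of 2 R0] by auto
  \<comment> \<open>The 4 comes from \<open>quadratic_bounds_of_young\<close>;
    \<open>M\<^sup>2 + 1\<close> in place of \<open>M\<^sup>2\<close> makes \<open>C\<close>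
    positive even if \<open>M = 0\<close>.\<close>
  define C where "C = 4 * ((M\<^sup>2 + 1) * K)"
  have C0: "0 < C" using K by (simp add: C_def add_nonneg_pos)

  have step: "D k \<le> C * F (2 ^ k) \<and> (D k)\<^sup>2 \<le> C * F (2 ^ k) * (D (Suc k) - D k)" if k: "N \<le> k" for k
  proof -
    define R :: real where "R = 2 ^ k"
    have "(2::real) ^ N \<le> 2 ^ k" using k by (intro power_increasing) auto
    with N have R: "0 < R" "R0 \<le> R" unfolding R_def by (simp, linarith)
    have D_R: "D k = (\<Sum>i=1..m. LINT x:B R|lebesgue. g i x)"
      and D_2R: "D (Suc k) = (\<Sum>i=1..m. LINT x:B (2 * R)|lebesgue. g i x)"
      by (simp_all add: D_def R_def)
    obtain \<psi> :: "real^'n \<Rightarrow> real" where s: "smooth \<psi>" and \<psi>: "\<And>x. 0 \<le> \<psi> x" "\<And>x. \<psi> x \<le> 1"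
      and one: "\<And>x. norm x < R \<Longrightarrow> \<psi> x = 1" and zero: "\<And>x. 2 * R \<le> norm x \<Longrightarrow> \<psi> x = 0"
      and grad: "\<And>x. norm (gradient \<psi> x) \<le> M / R" "\<And>x. norm x < R \<Longrightarrow> gradient \<psi> x = 0"
      using cutoffs[rule_format, OF R(1)] by blast
    define e where "e i x = (\<phi> i x)\<^sup>2 * (norm (G i x))\<^sup>2 * (\<psi> x)\<^sup>2" for i x
    have e_eq: "e i x = g i x * (\<psi> x)\<^sup>2" for i x by (simp add: e_def g_def)
    have \<psi>sq: "0 \<le> (\<psi> x)\<^sup>2" "(\<psi> x)\<^sup>2 \<le> 1" for x using \<psi>[of x] by (auto simp: power_le_one)
    have g0: "0 \<le> g i x" for i x by (simp add: g_def)
    have e0: "0 \<le> e i x" and eg: "e i x \<le> g i x" for i x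
      using \<psi>sq[of x] g0[of i x] by (simp_all add: e_eq mult_left_le)
    define E EA where "E = (\<Sum>i=1..m. LINT x|lebesgue. e i x)"
      and "EA = (\<Sum>i=1..m. LINT x:A R|lebesgue. e i x)"
    have e_supp: "indicator (B (2 * R)) x *\<^sub>R e i x = e i x" for i x
      using zero[of x] by (auto simp: e_eq B_def indicator_def)
    have e_int: "integrable lebesgue (e i)" if i: "i \<in> {1..m}" for i
    proof -
      have "(\<lambda>x. (\<psi> x)\<^sup>2) \<in> borel_measurable lebesgue"
        by (intro borel_measurable_power smooth_lebesgue_measurable s)
      then have "set_integrable lebesgue (B (2 * R)) (e i)"
        unfolding e_eq[abs_def] by (intro set_integrable_bounded_mult g_int i) (simp_all add: \<psi>sq)
      then show ?thesis by (simp only: set_integrable_def e_supp)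
    qed
    have A_sets: "A r \<in> sets lebesgue" for r by (simp add: A_def B_def)
    have eA_int: "integrable lebesgue (\<lambda>x. indicator (A R) x *\<^sub>R e i x)" if i: "i \<in> {1..m}" for i
      by (rule integrable_mult_indicator[OF A_sets e_int[OF i]])
    have gB: "integrable lebesgue (\<lambda>x. indicator (B r) x *\<^sub>R g i x)" if i: "i \<in> {1..m}" for i r
      using g_int[OF i] by (simp add: set_integrable_def)

    have test: "(\<lambda>x. (\<psi> x)\<^sup>2) \<in> test_functions"
      by (rule test_functionI[of _ "2 * R"]) (use s zero in \<open>auto simp: power2_eq_square intro!: smooth_mult\<close>)
    have ineq: "(\<Sum>i=1..m. LINT x|lebesgue. (\<phi> i x)\<^sup>2 * ((norm (G i x))\<^sup>2 * (\<psi> x)\<^sup>2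
        + \<sigma> i x * (G i x \<bullet> gradient (\<lambda>x. (\<psi> x)\<^sup>2) x))) \<le> 0"
      \<comment> \<open>Testing with the squared cutoff shows that the first integrals in
        \<open>local_energy_estimate\<close> have a nonpositive sum over \<open>i\<close>, so they
        drop out. Only this sum has a sign, not the individual terms, so the energies are summed
        over \<open>i\<close> throughout.\<close>
      using assms(7) test unfolding weak_div_ineq_def G_def by fastforce
    have young: "E \<le> t * EA + (M / R)\<^sup>2 * S R / t" if t: "0 < t" for t
    proof -
      have "E \<le> (\<Sum>i=1..m. (LINT x|lebesgue. (\<phi> i x)\<^sup>2 * ((norm (G i x))\<^sup>2 * (\<psi> x)\<^sup>2
            + \<sigma> i x * (G i x \<bullet> gradient (\<lambda>x. (\<psi> x)\<^sup>2) x)))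
          + t * (LINT x:A R|lebesgue. e i x)
          + (M / R)\<^sup>2 / t * (LINT x:A R|lebesgue. (\<phi> i x)\<^sup>2 * (\<sigma> i x)\<^sup>2))"
        unfolding E_def e_def A_def B_def
        by (intro sum_mono local_energy_estimate \<phi> \<sigma>2 G2 s \<psi> zero grad t)
      also have "\<dots> = (\<Sum>i=1..m. LINT x|lebesgue. (\<phi> i x)\<^sup>2 * ((norm (G i x))\<^sup>2 * (\<psi> x)\<^sup>2
            + \<sigma> i x * (G i x \<bullet> gradient (\<lambda>x. (\<psi> x)\<^sup>2) x)))
          + t * EA + (M / R)\<^sup>2 / t * S R"
        by (simp add: sum.distrib sum_distrib_left EA_def S_def)
      finally show ?thesis using ineq by simp
    qed
    have EA0: "0 \<le> EA"
      unfolding EA_def set_lebesgue_integral_def by (intro sum_nonneg integral_nonneg) (simp add: e0)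
    have EA_E: "EA \<le> E"
      unfolding EA_def E_def set_lebesgue_integral_def
      by (intro sum_mono integral_mono eA_int e_int) (auto simp: indicator_def e0)
    have D_E: "D k \<le> E"
      unfolding D_R E_def set_lebesgue_integral_def
      by (intro sum_mono integral_mono gB e_int) (auto simp: indicator_def e0 e_eq g0 one B_def)
    \<comment> \<open>The annulus is the difference of consecutive dyadic balls and
      \<open>e i x \<le> g i x\<close>, so the annular energy is at most the increment of
      \<open>D\<close>.\<close>
    have "EA \<le> (\<Sum>i=1..m. LINT x|lebesgue. indicator (B (2 * R)) x *\<^sub>R g i x - indicator (B R) x *\<^sub>R g i x)"
      unfolding EA_def set_lebesgue_integral_def
      using R by (intro sum_mono integral_mono eA_int Bochner_Integration.integrable_diff gB)
        (auto simp: indicator_def eg A_def B_def)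
    also have "\<dots> = (\<Sum>i=1..m. (LINT x:B (2 * R)|lebesgue. g i x) - (LINT x:B R|lebesgue. g i x))"
      unfolding set_lebesgue_integral_def
      by (intro sum.cong refl Bochner_Integration.integral_diff gB)
    also have "\<dots> = D (Suc k) - D k"
      by (simp add: D_R D_2R sum_subtractf)
    finally have EA_D: "EA \<le> D (Suc k) - D k" .
    \<comment> \<open>The squared gradient bound contributes \<open>1 / R\<^sup>2\<close>, which
      cancels the \<open>R\<^sup>2\<close> of the growth condition and leaves a multiple of
      \<open>F R\<close>.\<close>
    have "S R \<le> K * (R\<^sup>2 * F R)"
      using R0[OF R(2)] F0[OF R(1)] R(1) by (simp add: field_simps)
    then have "(M / R)\<^sup>2 * S R \<le> (M / R)\<^sup>2 * (K * (R\<^sup>2 * F R))"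
      by (rule mult_left_mono) simp
    also have "\<dots> = M\<^sup>2 * K * F R"
      using R(1) by (simp add: power_divide)
    also have "\<dots> \<le> (M\<^sup>2 + 1) * K * F R"
      using K F0[OF R(1)] by (intro mult_right_mono) auto
    finally have G: "(M / R)\<^sup>2 * S R \<le> (M\<^sup>2 + 1) * K * F R" .
    have G0: "0 \<le> (M / R)\<^sup>2 * S R" using S0 by simp
    from quadratic_bounds_of_young[OF young EA0 EA_E EA_D D0 D_E G0 G]
    show ?thesis by (simp add: C_def R_def mult.assoc)
  qed
  have D_zero: "D k = 0" if "N \<le> k" for k
    by (rule zero_if_reciprocals_not_summable[OF C0 _ D0 _ _ class_F_not_summable[OF assms(5)] that])
      (use step F0 in auto)
  show ?thesis
  proof
    fix i assume i: "i \<in> {1..m}"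
    have "AE x in lebesgue. x \<in> B (2 ^ k) \<longrightarrow> g i x = 0" if k: "N \<le> k" for k
    proof -
      \<comment> \<open>A vanishing sum of nonnegative energies vanishes term by term.\<close>
      have "(LINT x:B (2 ^ k)|lebesgue. g i x) = 0"
        using D_zero[OF k] i unfolding D_def
        by (subst (asm) sum_nonneg_eq_0_iff) (auto simp: set_lebesgue_integral_def g_def intro!: integral_nonneg)
      then have "AE x in lebesgue. indicator (B (2 ^ k)) x *\<^sub>R g i x = 0"
        unfolding set_lebesgue_integral_def
        using integral_nonneg_eq_0_iff_AE[OF g_int[OF i, of "2 ^ k", unfolded set_integrable_def]]
        by (simp add: g_def)
      then show ?thesis by eventually_elim auto
    qed
    then have "AE x in lebesgue. \<forall>k. N \<le> k \<longrightarrow> x \<in> B (2 ^ k) \<longrightarrow> g i x = 0"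
      unfolding AE_all_countable by (intro allI AE_impI)
    \<comment> \<open>The sign condition makes the weight nonzero almost everywhere, so vanishing of
      \<open>g i\<close> forces \<open>G i\<close> to vanish.\<close>
    moreover have "AE x in lebesgue. \<phi> i x \<noteq> 0"
      using assms(3)[OF i]
    proof
      assume "AE x in lebesgue. \<phi> i x > 0"
      then show ?thesis by eventually_elim simp
    next
      assume "AE x in lebesgue. \<phi> i x < 0"
      then show ?thesis by eventually_elim simp
    qed
    ultimately have "AE x in lebesgue. G i x = 0"
    proof eventually_elim
      case (elim x)
      obtain k where "norm x < 2 ^ k" using real_arch_pow[of 2 "norm x"] by auto
      \<comment> \<open>Enlarging the exponent to \<open>max N k\<close> brings the ball containing
        \<open>x\<close> into the range \<open>N \<le> k\<close> where the energy is known to be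
        zero.\<close>
      also have "(2::real) ^ k \<le> 2 ^ max N k" by (intro power_increasing) auto
      finally have "x \<in> B (2 ^ max N k)" by (simp add: B_def)
      then have "g i x = 0" using elim(1) by (meson max.cobounded1)
      with elim(2) show ?case by (simp add: g_def)
    qed
    then show "\<exists>c. AE x in lebesgue. \<sigma> i x = c"
      unfolding G_def by (rule AE_const_if_weak_gradient_zero[OF H1_locD(3)[OF \<sigma>[OF i]]])
  qed
qed

end
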